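(* Let $D\subset\mathbb R^d$, $d\in\{2,3\}$, be a bounded $C^{1,1}$ domain. Let $\mu\in C^{0,1}(\overline D)$ be uniformly elliptic and let $g\ge g_{\min}>0$ be the Dirichlet boundary datum. Define $L:=-\nabla\cdot(\mu\nabla\,\cdot)$, let $K:L^2(D)\to H^2(D)\cap H^1_0(D)\hookrightarrow L^2(D)$ be the Dirichlet inverse of $L$, and let $\tilde g$ denote the $L$-harmonic extension of $g$. For $v\in L^2(D)$ define $$u(v):=Kv+\tilde g,\qquad e(v):=\frac{v}{u(v)} .$$ Consider the linear white-noise observation model $Y=v+\varepsilon\xi$, where $v=\gamma u$. Let $\Pi_v$ be a prior for $v$ on an admissible subset of $L^2(D)$ and define the induced prior $\Pi_\gamma:=e_{\#}\Pi_v=\Pi_v\circ e^{-1}$ for $\gamma$. Denote the corresponding posteriors by $\Pi_v(\cdot\mid Y)$ and $\Pi_\gamma(\cdot\mid Y):=\Pi_v(\cdot\mid Y)\circ e^{-1}$. Let $v_0$ be the true value of $v$ and $\gamma_0=e(v_0)$. Let $V_\star\subset L^2(D)$ be a set with $v_0\in V_\star$ for which there are constants $m>0$, $M<\infty$ such that $\inf_{x\in D}u(v)(x)\ge m$ and $\sup_{x\in D}|e(v)(x)|\le M$ for all $v\in V_\star$. Suppose there exist measurable sets $V_\varepsilon\subset V_\star$ and $\delta_\varepsilon\downarrow0$ (as $\varepsilon\to0$) such that: (A1) for every $M_\varepsilon\to\infty$, $\Pi_v\bigl(\|v-v_0\|_{L^2}>M_\varepsilon\delta_\varepsilon\,\big|\,Y\bigr)\to0$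 in $P_{v_0}$-probability; (A2) $\Pi_v(V_\varepsilon\mid Y)\to1$ in $P_{v_0}$-probability; (A3) the map $e:V_\varepsilon\to L^2(D)$ is locally Lipschitz on $V_\varepsilon$. Then, for every $\widehat M_\varepsilon\to\infty$, $$\Pi_\gamma\bigl(\|\gamma-\gamma_0\|_{L^2}>\widehat M_\varepsilon\delta_\varepsilon\,\big|\,Y\bigr)\to0\quad\text{in }P_{\gamma_0}\text{-probability.}$$
   Context: The Dirichlet inverse $K$ is characterized by $L(Kw)=w$ in $D$, $Kw|_{\partial D}=0$; the $L$-harmonic extension $\tilde g$ by $L\tilde g=0$ in $D$, $\tilde g|_{\partial D}=g$ (with $g\in H^{1/2}(\partial D)$). Thus $u=u(v)$ with $v=\gamma u$ solves the quantitative photoacoustic tomography equation $-\nabla\cdot(\mu\nabla u)+\gamma u=0$ in $D$, $u=g$ on $\partial D$, for a suitable sign convention of the source $v$; here only the definitions of $u(v)$ and $e(v)$ given in the claim are used. The noise $\xi$ is Gaussian white noise and $\varepsilon>0$ is the noise level; the abstract model is understood in the sense of discrete observations $Y_i=v(x_i)+\varepsilon W_i$, $i=1,\dots,N$ ($N\to\infty$), at design points $x_i$, with $W_i$ i.i.d. $N(0,1)$. All limits are as $\varepsilon\to0$. $P_{v_0}$ is the law of $Y$ when the true parameter is $v_0$; since $\gamma_0=e(v_0)$, $P_{\gamma_0}$ denotes the same law. $\Pi_v(\cdot\mid Y)$ is the posterior for prior $\Pi_v$. The prior $\Pi_v$ is a probability measure on $L^2(D)$ (possibly depending on $\varepsilon$)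 concentrated on a measurable set on which $e$ is a well-defined measurable $L^2(D)$-valued map. *)

theory Defs
  imports "HOL-Probability.Probability"
begin

section \<open>The space of square-integrable functions on a domain\<close>

text \<open>
  Elements of \<open>L\<^sup>2(D)\<close> are represented by functions on the whole space whose values outside \<open>D\<close>
  are irrelevant. \<open>l2norm D\<close> is a seminorm whose kernel is almost everywhere equality on \<open>D\<close>; the
  open sets below, hence all sets of \<open>L2_borel D\<close>, are saturated for that relation, so
  \<open>L2_borel D\<close> is the Borel sigma-algebra of the quotient.
\<close>

definition L2 :: "(real^'n) set \<Rightarrow> (real^'n \<Rightarrow> real) set" where
  "L2 D = {f \<in> borel_measurable (lebesgue_on D). integrable (lebesgue_on D) (\<lambda>x. (f x)\<^sup>2)}"

definition l2norm :: "(real^'n) set \<Rightarrow> (real^'n \<Rightarrow> real) \<Rightarrow> real" where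
  "l2norm D f = sqrt (LINT x|lebesgue_on D. (f x)\<^sup>2)"

definition l2dist :: "(real^'n) set \<Rightarrow> (real^'n \<Rightarrow> real) \<Rightarrow> (real^'n \<Rightarrow> real) \<Rightarrow> real" where
  "l2dist D f h = l2norm D (\<lambda>x. f x - h x)"

definition L2_open :: "(real^'n) set \<Rightarrow> (real^'n \<Rightarrow> real) set \<Rightarrow> bool" where
  "L2_open D U \<longleftrightarrow> U \<subseteq> L2 D \<and> (\<forall>f\<in>U. \<exists>r>0. {h \<in> L2 D. l2dist D h f < r} \<subseteq> U)"

definition L2_borel :: "(real^'n) set \<Rightarrow> (real^'n \<Rightarrow> real) measure" where
  "L2_borel D = sigma (L2 D) {U. L2_open D U}"

definition L2_locally_lipschitz_on ::
  "(real^'n) set \<Rightarrow> (real^'n \<Rightarrow> real) set \<Rightarrow> ((real^'n \<Rightarrow> real) \<Rightarrow> (real^'n \<Rightarrow> real)) \<Rightarrow> bool" where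
  "L2_locally_lipschitz_on D V F \<longleftrightarrow>
     (\<forall>v\<in>V. \<exists>r>0. \<exists>C. \<forall>w1\<in>V. \<forall>w2\<in>V. l2dist D w1 v < r \<longrightarrow> l2dist D w2 v < r \<longrightarrow>
        l2dist D (F w1) (F w2) \<le> C * l2dist D w1 w2)"


section \<open>Smooth functions, weak derivatives, Sobolev spaces\<close>

definition partial_deriv :: "'n \<Rightarrow> (real^'n \<Rightarrow> real) \<Rightarrow> real^'n::finite \<Rightarrow> real" where
  "partial_deriv i f x = frechet_derivative f (at x) (axis i 1)"

definition grad :: "(real^'n \<Rightarrow> real) \<Rightarrow> real^'n::finite \<Rightarrow> real^'n" where
  "grad f x = (\<chi> i. partial_deriv i f x)"

primrec Ck :: "nat \<Rightarrow> (real^'n::finite \<Rightarrow> real) \<Rightarrow> bool" where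
  "Ck 0 f \<longleftrightarrow> continuous_on UNIV f"
| "Ck (Suc k) f \<longleftrightarrow> (\<forall>x. f differentiable (at x)) \<and> (\<forall>i. Ck k (partial_deriv i f))"

definition smooth :: "(real^'n::finite \<Rightarrow> real) \<Rightarrow> bool" where
  "smooth f \<longleftrightarrow> (\<forall>k. Ck k f)"

definition test_function :: "(real^'n::finite) set \<Rightarrow> (real^'n \<Rightarrow> real) \<Rightarrow> bool" where
  "test_function D \<phi> \<longleftrightarrow> smooth \<phi> \<and> compact (closure {x. \<phi> x \<noteq> 0}) \<and> closure {x. \<phi> x \<noteq> 0} \<subseteq> D"

definition weak_partial :: "(real^'n::finite) set \<Rightarrow> 'n \<Rightarrow> (real^'n \<Rightarrow> real) \<Rightarrow> (real^'n \<Rightarrow> real) \<Rightarrow> bool" where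
  "weak_partial D i w h \<longleftrightarrow>
     (\<forall>\<phi>. test_function D \<phi> \<longrightarrow>
        (LINT x|lebesgue_on D. w x * partial_deriv i \<phi> x) = - (LINT x|lebesgue_on D. h x * \<phi> x))"

text \<open>
  \<open>in_H1 D w G\<close>: \<open>w\<close> lies in \<open>H\<^sup>1(D)\<close> and \<open>G\<close> is its weak gradient, which is unique up to null sets.
\<close>

definition in_H1 :: "(real^'n::finite) set \<Rightarrow> (real^'n \<Rightarrow> real) \<Rightarrow> (real^'n \<Rightarrow> real^'n) \<Rightarrow> bool" where
  "in_H1 D w G \<longleftrightarrow> w \<in> L2 D \<and> (\<forall>i. (\<lambda>x. G x $ i) \<in> L2 D \<and> weak_partial D i w (\<lambda>x. G x $ i))"

definition in_H2 :: "(real^'n::finite) set \<Rightarrow> (real^'n \<Rightarrow> real) \<Rightarrow> (real^'n \<Rightarrow> real^'n) \<Rightarrow> bool" where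
  "in_H2 D w G \<longleftrightarrow> in_H1 D w G \<and> (\<forall>i. \<exists>H. in_H1 D (\<lambda>x. G x $ i) H)"

definition H1_approx ::
  "(real^'n::finite) set \<Rightarrow> (nat \<Rightarrow> real^'n \<Rightarrow> real) \<Rightarrow> (real^'n \<Rightarrow> real) \<Rightarrow> (real^'n \<Rightarrow> real^'n) \<Rightarrow> bool" where
  "H1_approx D \<phi> w G \<longleftrightarrow>
     (\<lambda>k. l2dist D (\<phi> k) w) \<longlonglongrightarrow> 0 \<and>
     (\<forall>i. (\<lambda>k. l2dist D (partial_deriv i (\<phi> k)) (\<lambda>x. G x $ i)) \<longlonglongrightarrow> 0)"

definition in_H10 :: "(real^'n::finite) set \<Rightarrow> (real^'n \<Rightarrow> real) \<Rightarrow> (real^'n \<Rightarrow> real^'n) \<Rightarrow> bool" where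
  "in_H10 D w G \<longleftrightarrow> in_H1 D w G \<and> (\<exists>\<phi>. (\<forall>k. test_function D (\<phi> k)) \<and> H1_approx D \<phi> w G)"


section \<open>Domains and boundary values\<close>

text \<open>
  Near each boundary point, \<open>D\<close> is the part above the graph of a \<open>C\<^sup>1\<^sup>,\<^sup>1\<close> function \<open>\<psi>\<close> in the
  direction \<open>\<nu>\<close>; invariance of \<open>\<psi>\<close> along \<open>\<nu>\<close> makes it a function on the hyperplane orthogonal to \<open>\<nu>\<close>.
\<close>

definition bounded_C11_domain :: "(real^'n::finite) set \<Rightarrow> bool" where
  "bounded_C11_domain D \<longleftrightarrow>
     D \<noteq> {} \<and> open D \<and> connected D \<and> bounded D \<and>
     (\<forall>p \<in> frontier D. \<exists>r>0. \<exists>\<nu> \<psi> G C.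
        norm \<nu> = 1 \<and> (\<forall>x t. \<psi> (x + t *\<^sub>R \<nu>) = \<psi> x) \<and>
        (\<forall>x. (\<psi> has_derivative (\<lambda>h. G x \<bullet> h)) (at x)) \<and> C-lipschitz_on UNIV G \<and>
        D \<inter> ball p r = {x \<in> ball p r. \<psi> x < x \<bullet> \<nu>})"

text \<open>
  Hausdorff measure of positive integer dimension \<open>s\<close>, normalised to agree with Lebesgue measure on
  \<open>s\<close>-dimensional planes. By the Caratheodory criterion the outer measure is countably additive on
  Borel sets, so \<open>measure_of\<close> assigns it as the value of \<open>emeasure\<close>.
\<close>

definition hausdorff_outer :: "nat \<Rightarrow> 'a::metric_space set \<Rightarrow> ennreal" where
  "hausdorff_outer s A =
     (SUP \<rho>\<in>{0::real<..}. INF C\<in>{C :: nat \<Rightarrow> 'a set. A \<subseteq> (\<Union>k. C k) \<and> (\<forall>k. bounded (C k) \<and> diameter (C k) \<le> \<rho>)}.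
        \<Sum>k. ennreal (unit_ball_vol (real s) * (diameter (C k) / 2) ^ s))"

definition hausdorff_measure :: "nat \<Rightarrow> 'a::metric_space measure" where
  "hausdorff_measure s = measure_of UNIV (sets borel) (hausdorff_outer s)"

definition surface_measure :: "(real^'n::finite) set \<Rightarrow> (real^'n) measure" where
  "surface_measure D = restrict_space (hausdorff_measure (CARD('n) - 1)) (frontier D)"

text \<open>
  \<open>H\<^sup>1\<^sup>/\<^sup>2\<close> of the boundary, by the Sobolev--Slobodeckij seminorm: the exponent
  \<open>(d - 1) + 2 \<sqdot> 1/2\<close> of the kernel is \<open>d\<close>.
\<close>

definition H_half_boundary :: "(real^'n::finite) set \<Rightarrow> (real^'n \<Rightarrow> real) set" where
  "H_half_boundary D = {g \<in> borel_measurable (surface_measure D).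
     (\<integral>\<^sup>+x. ennreal ((g x)\<^sup>2) \<partial>surface_measure D) < \<infinity> \<and>
     (\<integral>\<^sup>+x. \<integral>\<^sup>+y. ennreal ((g x - g y)\<^sup>2 / dist x y ^ CARD('n)) \<partial>surface_measure D \<partial>surface_measure D) < \<infinity>}"

text \<open>
  The trace operator is the continuous extension to \<open>H\<^sup>1(D)\<close> of the restriction to the boundary of
  functions that are smooth up to the boundary.
\<close>

definition has_trace ::
  "(real^'n::finite) set \<Rightarrow> (real^'n \<Rightarrow> real) \<Rightarrow> (real^'n \<Rightarrow> real^'n) \<Rightarrow> (real^'n \<Rightarrow> real) \<Rightarrow> bool" where
  "has_trace D w G g \<longleftrightarrow>
     (\<exists>\<phi>. (\<forall>k. smooth (\<phi> k)) \<and> H1_approx D \<phi> w G \<and>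
        (\<lambda>k. \<integral>\<^sup>+x. ennreal ((\<phi> k x - g x)\<^sup>2) \<partial>surface_measure D) \<longlonglongrightarrow> 0)"


section \<open>The elliptic operator and the nonlinear map\<close>

text \<open>
  \<open>elliptic_eq D \<mu> G f\<close>: \<open>- div (\<mu> G) = f\<close> in \<open>D\<close> in the distributional sense, where \<open>G\<close> is the weak
  gradient of the unknown.
\<close>

definition elliptic_eq ::
  "(real^'n::finite) set \<Rightarrow> (real^'n \<Rightarrow> real) \<Rightarrow> (real^'n \<Rightarrow> real^'n) \<Rightarrow> (real^'n \<Rightarrow> real) \<Rightarrow> bool" where
  "elliptic_eq D \<mu> G f \<longleftrightarrow>
     (\<forall>\<phi>. test_function D \<phi> \<longrightarrow>
        (LINT x|lebesgue_on D. \<mu> x * (G x \<bullet> grad \<phi> x)) = (LINT x|lebesgue_on D. f x * \<phi> x))"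

definition dirichlet_inverse ::
  "(real^'n::finite) set \<Rightarrow> (real^'n \<Rightarrow> real) \<Rightarrow> ((real^'n \<Rightarrow> real) \<Rightarrow> (real^'n \<Rightarrow> real)) \<Rightarrow> bool" where
  "dirichlet_inverse D \<mu> K \<longleftrightarrow>
     (\<forall>w\<in>L2 D. \<exists>G. in_H2 D (K w) G \<and> in_H10 D (K w) G \<and> elliptic_eq D \<mu> G w)"

definition harmonic_extension ::
  "(real^'n::finite) set \<Rightarrow> (real^'n \<Rightarrow> real) \<Rightarrow> (real^'n \<Rightarrow> real) \<Rightarrow> (real^'n \<Rightarrow> real) \<Rightarrow> bool" where
  "harmonic_extension D \<mu> g gt \<longleftrightarrow>
     (\<exists>G. in_H1 D gt G \<and> has_trace D gt G g \<and> elliptic_eq D \<mu> G (\<lambda>x. 0))"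

definition u_of ::
  "((real^'n \<Rightarrow> real) \<Rightarrow> (real^'n \<Rightarrow> real)) \<Rightarrow> (real^'n \<Rightarrow> real) \<Rightarrow> (real^'n \<Rightarrow> real) \<Rightarrow> real^'n \<Rightarrow> real" where
  "u_of K gt v x = K v x + gt x"

definition e_of ::
  "((real^'n \<Rightarrow> real) \<Rightarrow> (real^'n \<Rightarrow> real)) \<Rightarrow> (real^'n \<Rightarrow> real) \<Rightarrow> (real^'n \<Rightarrow> real) \<Rightarrow> real^'n \<Rightarrow> real" where
  "e_of K gt v x = v x / u_of K gt v x"


section \<open>Observations and posteriors\<close>

text \<open>
  Value of an \<open>L\<^sup>2\<close> class at a point, independent of the representative: the limit of the averages
  over shrinking balls, and \<open>0\<close> where the limit does not exist.
\<close>

definition point_value :: "(real^'n::finite) set \<Rightarrow> (real^'n \<Rightarrow> real) \<Rightarrow> real^'n \<Rightarrow> real" where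
  "point_value D v x =
     (let avg = (\<lambda>r. (LINT y|lebesgue_on (D \<inter> ball x r). v y) / measure lebesgue (D \<inter> ball x r))
      in if \<exists>l. (avg \<longlongrightarrow> l) (at_right 0) then Lim (at_right 0) avg else 0)"

lemma point_value_continuous:
  fixes D :: "(real^'n::finite) set"
  assumes "open D" "x \<in> D" "continuous_on D v"
  shows "point_value D v x = v x"
proof -
  define avg where
    "avg = (\<lambda>r. (LINT y|lebesgue_on (D \<inter> ball x r). v y) / measure lebesgue (D \<inter> ball x r))"
  have "(avg \<longlongrightarrow> v x) (at_right 0)"
  proof (rule tendstoI)
    fix e :: real assume e: "e > 0"
    obtain r1 where r1: "r1 > 0" "cball x r1 \<subseteq> D"
      using assms(1,2) open_contains_cball by blast
    obtain r2 where r2: "r2 > 0" "\<And>y. y \<in> D \<Longrightarrow> dist y x < r2 \<Longrightarrow> dist (v y) (v x) < e/2"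
      using assms(2,3) e unfolding continuous_on_iff by (metis half_gt_zero)
    have "dist (avg r) (v x) < e" if r: "0 < r" "r < min r1 r2" for r
    proof -
      let ?B = "ball x r"
      have sub: "?B \<subseteq> D" "cball x r \<subseteq> D" using r r1 by auto
      have DB: "D \<inter> ?B = ?B" using sub by auto
      have B: "?B \<in> lmeasurable" by simp
      have pos: "measure lebesgue ?B > 0" using r(1) by (simp add: content_ball_pos)
      have "integrable lborel (\<lambda>y. indicator (cball x r) y *\<^sub>R v y)"
        by (rule borel_integrable_compact) (use sub assms(3) continuous_on_subset in auto)
      then have "v absolutely_integrable_on cball x r"
        unfolding set_integrable_def by (subst integrable_completion) auto
      then have "v absolutely_integrable_on ?B"
        by (rule set_integrable_subset) auto
      then have iv: "integrable (lebesgue_on ?B) v"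
        by (simp add: integrable_restrict_space set_integrable_def)
      have ic: "integrable (lebesgue_on ?B) (\<lambda>y. c)" for c :: real
        using B by (simp add: integrable_restrict_space lmeasurable_iff_integrable
            fmeasurable_def emeasure_restrict_space)
      have c: "(LINT y|lebesgue_on ?B. c) = c * measure lebesgue ?B" for c :: real
        by (simp add: measure_restrict_space)
      have "\<bar>(LINT y|lebesgue_on ?B. v y) - v x * measure lebesgue ?B\<bar>
          = \<bar>LINT y|lebesgue_on ?B. v y - v x\<bar>"
        by (simp only: c[symmetric] Bochner_Integration.integral_diff[OF iv ic])
      also have "\<dots> \<le> (LINT y|lebesgue_on ?B. \<bar>v y - v x\<bar>)"
        by (rule integral_abs_bound)
      also have "\<dots> \<le> (LINT y|lebesgue_on ?B. e/2)"
      proof (rule integral_mono)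
        show "integrable (lebesgue_on ?B) (\<lambda>y. \<bar>v y - v x\<bar>)"
          using iv ic by (intro integrable_abs Bochner_Integration.integrable_diff) auto
        fix y assume "y \<in> space (lebesgue_on ?B)"
        then have "y \<in> ?B" by simp
        then have "y \<in> D" "dist y x < r2" using sub r by (auto simp: dist_commute)
        then show "\<bar>v y - v x\<bar> \<le> e/2" using r2(2)[of y] by (simp add: dist_real_def)
      qed (rule ic)
      also have "\<dots> = e/2 * measure lebesgue ?B" by (rule c)
      finally have *: "\<bar>(LINT y|lebesgue_on ?B. v y) - v x * measure lebesgue ?B\<bar> \<le> e/2 * measure lebesgue ?B" .
      have "avg r - v x = ((LINT y|lebesgue_on ?B. v y) - v x * measure lebesgue ?B) / measure lebesgue ?B"
        using pos by (simp add: avg_def DB field_simps)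
      then have "\<bar>avg r - v x\<bar>
          = \<bar>(LINT y|lebesgue_on ?B. v y) - v x * measure lebesgue ?B\<bar> / measure lebesgue ?B"
        using pos by (simp only: abs_divide abs_of_pos)
      also have "\<dots> \<le> e/2"
        using * pos by (simp only: pos_divide_le_eq)
      finally have "\<bar>avg r - v x\<bar> \<le> e/2" .
      then show ?thesis using e by (simp add: dist_real_def)
    qed
    then show "eventually (\<lambda>r. dist (avg r) (v x) < e) (at_right 0)"
      using r1(1) r2(1) by (auto simp: eventually_at_right_field intro!: exI[of _ "min r1 r2"])
  qed
  moreover from this have "Lim (at_right 0) avg = v x"
    by (intro tendsto_Lim) auto
  ultimately show ?thesis
    unfolding point_value_def avg_def[symmetric] Let_def by auto
qed

text \<open>
  Law of \<open>Y\<^sub>i = v(x\<^sub>i) + \<epsilon> W\<^sub>i\<close> for \<open>i < N\<close>, with \<open>W\<^sub>i\<close> independent standard Gaussian.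
\<close>

definition data_law ::
  "(real^'n::finite) set \<Rightarrow> real \<Rightarrow> nat \<Rightarrow> (nat \<Rightarrow> real^'n) \<Rightarrow> (real^'n \<Rightarrow> real) \<Rightarrow> (nat \<Rightarrow> real) measure" where
  "data_law D \<epsilon> N x v =
     distr (PiM {..<N} (\<lambda>_. std_normal_distribution)) (PiM {..<N} (\<lambda>_. borel))
       (\<lambda>W. \<lambda>i\<in>{..<N}. point_value D v (x i) + \<epsilon> * W i)"

definition likelihood ::
  "(real^'n::finite) set \<Rightarrow> real \<Rightarrow> nat \<Rightarrow> (nat \<Rightarrow> real^'n) \<Rightarrow> (real^'n \<Rightarrow> real) \<Rightarrow> (nat \<Rightarrow> real) \<Rightarrow> real" where
  "likelihood D \<epsilon> N x v Y = (\<Prod>i<N. normal_density (point_value D v (x i)) \<epsilon> (Y i))"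

definition posterior ::
  "(real^'n::finite) set \<Rightarrow> real \<Rightarrow> nat \<Rightarrow> (nat \<Rightarrow> real^'n) \<Rightarrow> (real^'n \<Rightarrow> real) measure
    \<Rightarrow> (nat \<Rightarrow> real) \<Rightarrow> (real^'n \<Rightarrow> real) measure" where
  "posterior D \<epsilon> N x Q Y =
     density Q (\<lambda>v. ennreal (likelihood D \<epsilon> N x v Y) / (\<integral>\<^sup>+w. ennreal (likelihood D \<epsilon> N x w Y) \<partial>Q))"

text \<open>
  Push-forward under \<open>e\<close> of a law concentrated on the admissible set \<open>A\<close>. Applied to the prior for
  \<open>v\<close> it is the induced prior for \<open>\<gamma>\<close>, applied to the posterior for \<open>v\<close> the posterior for \<open>\<gamma>\<close>.
\<close>

definition induced_law ::
  "(real^'n::finite) set \<Rightarrow> ((real^'n \<Rightarrow> real) \<Rightarrow> (real^'n \<Rightarrow> real)) \<Rightarrow> (real^'n \<Rightarrow> real)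
    \<Rightarrow> (real^'n \<Rightarrow> real) set \<Rightarrow> (real^'n \<Rightarrow> real) measure \<Rightarrow> (real^'n \<Rightarrow> real) measure" where
  "induced_law D K gt A Q = distr (restrict_space Q A) (L2_borel D) (e_of K gt)"

text \<open>Convergence in probability as the noise level tends to \<open>0\<close>, under laws depending on it.\<close>

definition tendsto_in_prob :: "(real \<Rightarrow> 'b measure) \<Rightarrow> (real \<Rightarrow> 'b \<Rightarrow> real) \<Rightarrow> real \<Rightarrow> bool" where
  "tendsto_in_prob P Z c \<longleftrightarrow>
     (\<forall>\<eta>>0. ((\<lambda>\<epsilon>. measure (P \<epsilon>) {y \<in> space (P \<epsilon>). \<eta> < \<bar>Z \<epsilon> y - c\<bar>}) \<longlongrightarrow> 0) (at_right 0))"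

end

theory Submission
  imports Defs
begin

text \<open>
  Contraction is transported from \<open>v\<close> to \<open>\<gamma> = e(v)\<close> by one deterministic estimate: there is a constant
  \<open>L\<close>, independent of \<open>\<epsilon>\<close>, with \<open>\<parallel>e(v) - e(v\<^sub>0)\<parallel> \<le> L \<parallel>v - v\<^sub>0\<parallel>\<close> for all \<open>v \<in> V\<^sub>\<star>\<close>. It follows from the
  pointwise identity \<open>e(v) - e(v\<^sub>0) = ((v - v\<^sub>0) - e(v\<^sub>0) (K v - K v\<^sub>0)) / u(v)\<close>, from \<open>u(v) \<ge> m\<close> and
  \<open>\<bar>e(v\<^sub>0)\<bar> \<le> M\<close> (\<open>e_of_L2_lipschitz\<close>), and from the Lipschitz continuity of the Dirichlet inverse
  \<open>K\<close> on \<open>L\<^sup>2(D)\<close> (\<open>dirichlet_inverse_L2_lipschitz\<close>). The latter is the energy estimate: the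
  equation for \<open>K v - K w\<close> is tested with \<open>K v - K w\<close> itself and combined with ellipticity and the
  Poincare inequality.

  Consequently, if \<open>\<parallel>\<gamma> - \<gamma>\<^sub>0\<parallel> > R\<^sub>\<epsilon> \<delta>\<^sub>\<epsilon>\<close> for \<open>\<gamma> = e(v)\<close>, then either \<open>v \<notin> V\<^sub>\<epsilon>\<close> or
  \<open>\<parallel>v - v\<^sub>0\<parallel> > (R\<^sub>\<epsilon> / L) \<delta>\<^sub>\<epsilon>\<close>. The posterior probability of the first event tends to zero because that of
  \<open>V\<^sub>\<epsilon>\<close> tends to one, and that of the second by contraction at \<open>v\<^sub>0\<close>, since \<open>R\<^sub>\<epsilon> / L\<close> tends to infinity.

  This union bound is an argument about probabilities under the law of \<open>Y\<close>, and needs the posterior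
  to be a probability measure that depends measurably on \<open>Y\<close>. That rests on the measurability of
  \<open>v \<mapsto> v(x\<^sub>i)\<close>, where the point value of an \<open>L\<^sup>2\<close> class is a limit of averages over shrinking balls:
  left-continuity in the radius reduces the limit to countably many radii, and each average is a
  continuous functional of \<open>v\<close> (\<open>borel_measurable_point_value\<close>).
\<close>

section \<open>The Hilbert space structure of square-integrable functions\<close>

lemma integrable_mult_of_integrable_squares:
  fixes f h :: "'a \<Rightarrow> real"
  assumes [measurable]: "f \<in> borel_measurable M" "h \<in> borel_measurable M"
    and "integrable M (\<lambda>x. (f x)\<^sup>2)" "integrable M (\<lambda>x. (h x)\<^sup>2)"
  shows "integrable M (\<lambda>x. f x * h x)"
proof (rule Bochner_Integration.integrable_bound)
  show "integrable M (\<lambda>x. (f x)\<^sup>2 + (h x)\<^sup>2)"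
    using assms by simp
  have "\<bar>f x * h x\<bar> \<le> (f x)\<^sup>2 + (h x)\<^sup>2" for x
    using sum_squares_bound[of "\<bar>f x\<bar>" "\<bar>h x\<bar>"] mult_nonneg_nonneg[of "\<bar>f x\<bar>" "\<bar>h x\<bar>"]
    unfolding abs_mult by (simp del: mult_nonneg_nonneg)
  then show "AE x in M. norm (f x * h x) \<le> norm ((f x)\<^sup>2 + (h x)\<^sup>2)"
    by simp
qed measurable

lemma Cauchy_Schwarz_integral:
  fixes f h :: "'a \<Rightarrow> real"
  assumes m: "f \<in> borel_measurable M" "h \<in> borel_measurable M"
    and i: "integrable M (\<lambda>x. (f x)\<^sup>2)" "integrable M (\<lambda>x. (h x)\<^sup>2)"
  shows "\<bar>LINT x|M. f x * h x\<bar> \<le> sqrt (LINT x|M. (f x)\<^sup>2) * sqrt (LINT x|M. (h x)\<^sup>2)"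
proof -
  let ?A = "LINT x|M. (f x)\<^sup>2" and ?B = "LINT x|M. f x * h x" and ?C = "LINT x|M. (h x)\<^sup>2"
  have fh: "integrable M (\<lambda>x. f x * h x)"
    by (rule integrable_mult_of_integrable_squares[OF m i])
  have quad: "0 \<le> ?A + 2 * t * ?B + t\<^sup>2 * ?C" for t
  proof -
    have "0 \<le> (LINT x|M. (f x + t * h x)\<^sup>2)" by simp
    also have "\<dots> = (LINT x|M. (f x)\<^sup>2 + 2 * t * (f x * h x) + t\<^sup>2 * (h x)\<^sup>2)"
      by (simp add: power2_sum power_mult_distrib algebra_simps)
    also have "\<dots> = ?A + 2 * t * ?B + t\<^sup>2 * ?C"
      using i fh by simp
    finally show ?thesis .
  qed
  have "?B\<^sup>2 \<le> ?A * ?C"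
  proof (cases "?C = 0")
    case True
    have "?B = 0"
    proof (rule ccontr)
      assume "?B \<noteq> 0"
      then show False using quad[of "- (?A + 1) / (2 * ?B)"] True by (simp add: field_simps)
    qed
    then show ?thesis using True by simp
  next
    case False
    moreover have "?C \<ge> 0" by simp
    ultimately have "?C > 0" by linarith
    then show ?thesis using quad[of "- ?B / ?C"]
      by (simp add: field_simps power2_eq_square)
  qed
  then have "sqrt (?B\<^sup>2) \<le> sqrt (?A * ?C)" by (rule real_sqrt_le_mono)
  then show ?thesis by (simp add: real_sqrt_mult)
qed

lemma le_of_mult_self_le:
  fixes a b :: real
  assumes "0 \<le> a" "0 \<le> b" "a * a \<le> b * a"
  shows "a \<le> b"
  using assms by (cases "a = 0") (auto simp: mult_le_cancel_right)

lemma L2_measurable: "f \<in> L2 D \<Longrightarrow> f \<in> borel_measurable (lebesgue_on D)"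
  and L2_integrable_square: "f \<in> L2 D \<Longrightarrow> integrable (lebesgue_on D) (\<lambda>x. (f x)\<^sup>2)"
  by (auto simp: L2_def)

lemma L2_integrable_mult: "f \<in> L2 D \<Longrightarrow> h \<in> L2 D \<Longrightarrow> integrable (lebesgue_on D) (\<lambda>x. f x * h x)"
  by (intro integrable_mult_of_integrable_squares L2_measurable L2_integrable_square)

lemma L2_Cauchy_Schwarz:
  "f \<in> L2 D \<Longrightarrow> h \<in> L2 D \<Longrightarrow> \<bar>LINT x|lebesgue_on D. f x * h x\<bar> \<le> l2norm D f * l2norm D h"
  unfolding l2norm_def by (intro Cauchy_Schwarz_integral L2_measurable L2_integrable_square)

lemma l2norm_nonneg: "0 \<le> l2norm D f" and l2dist_nonneg: "0 \<le> l2dist D f h"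
  by (auto simp: l2norm_def l2dist_def)

lemma l2norm_square: "(l2norm D f)\<^sup>2 = (LINT x|lebesgue_on D. (f x)\<^sup>2)"
  by (simp add: l2norm_def)

lemma l2dist_commute: "l2dist D f h = l2dist D h f"
  by (simp add: l2dist_def l2norm_def power2_commute)

lemma L2_add: "f \<in> L2 D \<Longrightarrow> h \<in> L2 D \<Longrightarrow> (\<lambda>x. f x + h x) \<in> L2 D"
  using L2_integrable_mult[of f D h] by (auto simp: L2_def power2_sum mult.assoc)

lemma L2_bounded_mult:
  assumes a: "a \<in> borel_measurable (lebesgue_on D)" "\<And>x. x \<in> D \<Longrightarrow> \<bar>a x\<bar> \<le> B"
    and f: "f \<in> L2 D"
  shows "(\<lambda>x. a x * f x) \<in> L2 D"
proof -
  have "integrable (lebesgue_on D) (\<lambda>x. (a x * f x)\<^sup>2)"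
  proof (rule Bochner_Integration.integrable_bound)
    show "integrable (lebesgue_on D) (\<lambda>x. B\<^sup>2 * (f x)\<^sup>2)"
      using L2_integrable_square[OF f] by simp
    show "(\<lambda>x. (a x * f x)\<^sup>2) \<in> borel_measurable (lebesgue_on D)"
      using a(1) L2_measurable[OF f] by measurable
    have "(a x)\<^sup>2 \<le> B\<^sup>2" if "x \<in> D" for x
      using a(2)[OF that] by (simp add: abs_le_square_iff[symmetric])
    then show "AE x in lebesgue_on D. norm ((a x * f x)\<^sup>2) \<le> norm (B\<^sup>2 * (f x)\<^sup>2)"
      by (intro AE_I2) (auto simp: power_mult_distrib intro!: mult_right_mono)
  qed
  then show ?thesis
    using a(1) L2_measurable[OF f] by (auto simp: L2_def)
qed

lemma L2_diff:
  assumes "f \<in> L2 D" "h \<in> L2 D"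
  shows "(\<lambda>x. f x - h x) \<in> L2 D"
  using L2_add[OF assms(1) L2_bounded_mult[of "\<lambda>_. -1" D 1, OF _ _ assms(2)]] by simp

lemma l2norm_add_le:
  assumes f: "f \<in> L2 D" and h: "h \<in> L2 D"
  shows "l2norm D (\<lambda>x. f x + h x) \<le> l2norm D f + l2norm D h"
proof (rule power2_le_imp_le)
  have "(l2norm D (\<lambda>x. f x + h x))\<^sup>2
      = (LINT x|lebesgue_on D. (f x)\<^sup>2 + (h x)\<^sup>2 + 2 * (f x * h x))"
    by (simp add: l2norm_square power2_sum mult.assoc)
  also have "\<dots> = (l2norm D f)\<^sup>2 + (l2norm D h)\<^sup>2 + 2 * (LINT x|lebesgue_on D. f x * h x)"
    using L2_integrable_square[OF f] L2_integrable_square[OF h] L2_integrable_mult[OF f h]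
    by (simp add: l2norm_square)
  also have "\<dots> \<le> (l2norm D f + l2norm D h)\<^sup>2"
    using L2_Cauchy_Schwarz[OF f h] by (simp add: power2_sum)
  finally show "(l2norm D (\<lambda>x. f x + h x))\<^sup>2 \<le> (l2norm D f + l2norm D h)\<^sup>2" .
qed (simp add: l2norm_nonneg)

lemma l2dist_triangle:
  assumes "f \<in> L2 D" "h \<in> L2 D" "k \<in> L2 D"
  shows "l2dist D f k \<le> l2dist D f h + l2dist D h k"
  using l2norm_add_le[OF L2_diff[OF assms(1,2)] L2_diff[OF assms(2,3)]]
  by (simp add: l2dist_def)

lemma abs_l2dist_diff_le:
  assumes "f \<in> L2 D" "h \<in> L2 D" "k \<in> L2 D"
  shows "\<bar>l2dist D f k - l2dist D h k\<bar> \<le> l2dist D f h"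
  using l2dist_triangle[OF assms] l2dist_triangle[OF assms(2,1,3)]
  by (simp add: l2dist_commute)

text \<open>
  Weak formulations hold for test functions only. The next two lemmas carry them, and the Poincare
  inequality, over to the \<open>H\<^sup>1\<close>-closure.
\<close>

lemma tendsto_integral_mult_L2:
  assumes F: "F \<in> L2 D" and \<phi>: "\<And>k. \<phi> k \<in> L2 D" and w: "w \<in> L2 D"
    and lim: "(\<lambda>k. l2dist D (\<phi> k) w) \<longlonglongrightarrow> 0"
  shows "(\<lambda>k. LINT x|lebesgue_on D. F x * \<phi> k x) \<longlonglongrightarrow> (LINT x|lebesgue_on D. F x * w x)"
proof (rule Lim_null[THEN iffD2], rule Lim_null_comparison)
  have "\<bar>(LINT x|lebesgue_on D. F x * \<phi> k x) - (LINT x|lebesgue_on D. F x * w x)\<bar>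
      \<le> l2norm D F * l2dist D (\<phi> k) w" for k
  proof -
    have "(LINT x|lebesgue_on D. F x * \<phi> k x) - (LINT x|lebesgue_on D. F x * w x)
        = (LINT x|lebesgue_on D. F x * (\<phi> k x - w x))"
      using L2_integrable_mult[OF F \<phi>] L2_integrable_mult[OF F w]
      by (simp add: right_diff_distrib)
    then show ?thesis
      using L2_Cauchy_Schwarz[OF F L2_diff[OF \<phi> w]] by (simp add: l2dist_def)
  qed
  then show "\<forall>\<^sub>F k in sequentially. norm ((LINT x|lebesgue_on D. F x * \<phi> k x)
      - (LINT x|lebesgue_on D. F x * w x)) \<le> l2norm D F * l2dist D (\<phi> k) w"
    by simp
  show "(\<lambda>k. l2norm D F * l2dist D (\<phi> k) w) \<longlonglongrightarrow> 0"
    using tendsto_mult_left[OF lim, of "l2norm D F"] by simp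
qed

lemma tendsto_l2dist:
  assumes "\<And>k. \<phi> k \<in> L2 D" "\<And>k. \<psi> k \<in> L2 D" "w \<in> L2 D" "z \<in> L2 D"
    and lim: "(\<lambda>k. l2dist D (\<phi> k) w) \<longlonglongrightarrow> 0" "(\<lambda>k. l2dist D (\<psi> k) z) \<longlonglongrightarrow> 0"
  shows "(\<lambda>k. l2dist D (\<phi> k) (\<psi> k)) \<longlonglongrightarrow> l2dist D w z"
proof (rule Lim_null[THEN iffD2], rule Lim_null_comparison)
  have "\<bar>l2dist D (\<phi> k) (\<psi> k) - l2dist D w z\<bar> \<le> l2dist D (\<phi> k) w + l2dist D (\<psi> k) z" for k
    using abs_l2dist_diff_le[OF assms(1)[of k] assms(3) assms(2)[of k]]
      abs_l2dist_diff_le[OF assms(2)[of k] assms(4,3)]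
    by (simp add: l2dist_commute)
  then show "\<forall>\<^sub>F k in sequentially. norm (l2dist D (\<phi> k) (\<psi> k) - l2dist D w z)
      \<le> l2dist D (\<phi> k) w + l2dist D (\<psi> k) z"
    by simp
  show "(\<lambda>k. l2dist D (\<phi> k) w + l2dist D (\<psi> k) z) \<longlonglongrightarrow> 0"
    using tendsto_add[OF lim] by simp
qed

lemma continuous_in_L2:
  fixes D :: "(real^'n::finite) set"
  assumes f: "continuous_on UNIV f" and D: "bounded D" "open D"
  shows "f \<in> L2 D"
proof -
  have "compact (f ` closure D)"
    using f D by (intro compact_continuous_image continuous_on_subset[OF f]) auto
  then obtain B where B: "\<And>x. x \<in> D \<Longrightarrow> \<bar>f x\<bar> \<le> B"
    using closure_subset by (fastforce dest!: compact_imp_bounded simp: bounded_iff)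
  have m: "f \<in> borel_measurable (lebesgue_on D)"
    using D by (intro continuous_imp_measurable_on_sets_lebesgue continuous_on_subset[OF f]) auto
  have "D \<in> lmeasurable"
    using D by (rule lmeasurable_open)
  then have "finite_measure (lebesgue_on D)"
    by (rule finite_measure_lebesgue_on)
  then have "(\<lambda>x. 1) \<in> L2 D"
    by (simp add: L2_def finite_measure.integrable_const)
  from L2_bounded_mult[OF m B this] show ?thesis by simp
qed

section \<open>The Poincare inequality\<close>

text \<open>
  Translation invariance of Lebesgue measure makes the integral of every difference quotient of
  \<open>h\<close> vanish, and the quotients converge to the derivative, dominated by a constant on a bounded set.
\<close>

lemma integral_directional_derivative_eq_0:
  fixes h h' :: "'a::euclidean_space \<Rightarrow> real" and b :: 'a
  assumes h: "continuous_on UNIV h" and h': "continuous_on UNIV h'"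
    and der: "\<And>x. ((\<lambda>t. h (x + t *\<^sub>R b)) has_real_derivative h' x) (at 0)"
    and S: "bounded S" "\<And>x. x \<notin> S \<Longrightarrow> h x = 0" "\<And>x. x \<notin> S \<Longrightarrow> h' x = 0"
  shows "(LINT x|lborel. h' x) = 0"
proof -
  obtain R where R: "\<And>x. x \<in> S \<Longrightarrow> norm x \<le> R"
    using S(1) by (auto simp: bounded_iff)
  have "compact (h' ` cball 0 R)"
    by (intro compact_continuous_image continuous_on_subset[OF h']) auto
  then obtain B0 where B0: "\<And>x. norm x \<le> R \<Longrightarrow> \<bar>h' x\<bar> \<le> B0"
    by (fastforce dest!: compact_imp_bounded simp: bounded_iff)
  define B where "B = max B0 0"
  have B: "\<bar>h' x\<bar> \<le> B" for x
    using B0[of x] R[of x] S(3)[of x] unfolding B_def by (cases "x \<in> S") auto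
  \<comment> \<open>The mean value theorem dominates the difference quotients by the supremum of the derivative.\<close>
  have lip: "\<bar>h (x + t *\<^sub>R b) - h x\<bar> \<le> B * \<bar>t\<bar>" for x t
  proof -
    have "((\<lambda>t. h (x + t *\<^sub>R b)) has_real_derivative h' (x + s *\<^sub>R b)) (at s within UNIV)" for s
      using der[of "x + s *\<^sub>R b"]
        DERIV_shift[of "\<lambda>t. h (x + t *\<^sub>R b)" "h' (x + s *\<^sub>R b)" 0 s]
      by (simp add: algebra_simps)
    then show ?thesis
      using field_differentiable_bound[of UNIV "\<lambda>t. h (x + t *\<^sub>R b)" "\<lambda>s. h' (x + s *\<^sub>R b)" B t 0] B
      by simp
  qed
  define q where "q k x = (h (x + inverse (Suc k) *\<^sub>R b) - h x) * Suc k" for k :: nat and x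
  have [measurable]: "h \<in> borel_measurable borel" "h' \<in> borel_measurable borel"
    using h h' by (auto intro: borel_measurable_continuous_onI)
  have inth: "integrable lborel h"
  proof -
    have "integrable lborel (\<lambda>x. indicator (cball 0 R) x *\<^sub>R h x)"
      by (intro borel_integrable_compact continuous_on_subset[OF h]) auto
    also have "(\<lambda>x. indicator (cball 0 R) x *\<^sub>R h x) = h"
      using R S(2) by (auto simp: indicator_def fun_eq_iff)
    finally show ?thesis .
  qed
  have trans: "integrable lborel (\<lambda>x. h (x + a))" "(LINT x|lborel. h (x + a)) = (LINT x|lborel. h x)" for a
    using integrable_distr[of "(+) a" lborel borel h] integral_distr[of "(+) a" lborel borel h] inth
    by (simp_all add: lborel_distr_plus add.commute)
  have "(\<lambda>k. LINT x|lborel. q k x) \<longlonglongrightarrow> (LINT x|lborel. h' x)"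
  proof (rule integral_dominated_convergence)
    show "integrable lborel (\<lambda>x. B * indicator (cball (0::'a) (R + norm b)) x)"
      using emeasure_lborel_cball_finite[of "0::'a" "R + norm b"]
      by (intro integrable_mult_right integrable_real_indicator) auto
    have "\<bar>q k x\<bar> \<le> B * indicator (cball (0::'a) (R + norm b)) x" for k x
    proof (cases "norm x \<le> R + norm b")
      case True
      have "\<bar>q k x\<bar> = \<bar>h (x + inverse (Suc k) *\<^sub>R b) - h x\<bar> * Suc k"
        by (simp only: q_def abs_mult abs_of_nat)
      also have "\<dots> \<le> B * \<bar>inverse (real (Suc k))\<bar> * Suc k"
        using lip[of x "inverse (Suc k)"] by (rule mult_right_mono) simp
      also have "\<dots> = B" by simp
      finally show ?thesis using True by simp
    next
      case False
      have "norm x \<le> norm (x + inverse (Suc k) *\<^sub>R b) + norm (inverse (Suc k) *\<^sub>R b)"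
        by (metis add_diff_cancel_right' norm_triangle_ineq4)
      moreover have "norm (inverse (Suc k) *\<^sub>R b) \<le> norm b"
        by (auto intro!: mult_left_le_one_le simp: inverse_le_1_iff)
      ultimately have "norm (x + inverse (Suc k) *\<^sub>R b) > R" "norm x > R"
        using False norm_ge_zero[of b] by linarith+
      then have "h (x + inverse (Suc k) *\<^sub>R b) = 0" "h x = 0"
        using R S(2) by force+
      then show ?thesis using False by (simp add: q_def)
    qed
    then show "AE x in lborel. norm (q k x) \<le> B * indicator (cball (0::'a) (R + norm b)) x" for k
      by simp
    have "(\<lambda>k. q k x) \<longlonglongrightarrow> h' x" for x
    proof -
      have "((\<lambda>t. (h (x + t *\<^sub>R b) - h x) / t) \<longlongrightarrow> h' x) (at 0)"
        using der[of x] by (simp add: has_field_derivative_iff)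
      moreover have "filterlim (\<lambda>k. inverse (real (Suc k))) (at 0) sequentially"
        unfolding filterlim_at using LIMSEQ_inverse_real_of_nat by auto
      ultimately have "(\<lambda>k. (h (x + inverse (Suc k) *\<^sub>R b) - h x) / inverse (Suc k)) \<longlonglongrightarrow> h' x"
        by (rule filterlim_compose)
      then show ?thesis by (simp add: q_def divide_inverse)
    qed
    then show "AE x in lborel. (\<lambda>k. q k x) \<longlonglongrightarrow> h' x"
      by simp
  qed (auto simp: q_def)
  moreover have "(LINT x|lborel. q k x) = 0" for k
    using trans inth by (simp add: q_def)
  ultimately show ?thesis
    by (simp add: LIMSEQ_const_iff)
qed

text \<open>
  Since \<open>\<partial>\<^sub>i (x\<^sub>i f\<^sup>2) = f\<^sup>2 + 2 x\<^sub>i f \<partial>\<^sub>i f\<close> integrates to zero,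
  \<open>\<parallel>f\<parallel>\<^sup>2 \<le> 2 R \<parallel>f\<parallel> \<parallel>\<partial>\<^sub>i f\<parallel>\<close> by Cauchy--Schwarz.
\<close>

lemma Poincare_inequality:
  fixes f f' :: "real^'n::finite \<Rightarrow> real"
  assumes f: "continuous_on UNIV f" and f': "continuous_on UNIV f'"
    and der: "\<And>x. ((\<lambda>t. f (x + t *\<^sub>R axis i 1)) has_real_derivative f' x) (at 0)"
    and D: "open D" "\<And>x. x \<in> D \<Longrightarrow> norm x \<le> R" "D \<noteq> {}"
    and zero: "\<And>x. x \<notin> D \<Longrightarrow> f x = 0"
  shows "l2norm D f \<le> 2 * R * l2norm D f'"
proof -
  have bd: "bounded D" using D(2) by (auto simp: bounded_iff)
  have R: "R \<ge> 0" using D(2,3) norm_ge_zero order_trans by blast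
  define h where "h x = x $ i * (f x)\<^sup>2" for x
  define h' where "h' x = (f x)\<^sup>2 + f x * (2 * x $ i * f' x)" for x
  note L = continuous_in_L2[OF _ bd D(1)]
  have fL: "f \<in> L2 D" and gL: "(\<lambda>x. 2 * x $ i * f' x) \<in> L2 D" and f'L: "f' \<in> L2 D"
    using f f' by (auto intro!: L continuous_intros)
  have cont: "continuous_on UNIV h" "continuous_on UNIV h'"
    unfolding h_def h'_def using f f' by (auto intro!: continuous_intros)
  have "(LINT x|lborel. h' x) = 0"
  proof (rule integral_directional_derivative_eq_0[OF cont _ bd])
    show "((\<lambda>t. h (x + t *\<^sub>R axis i 1)) has_real_derivative h' x) (at 0)" for x
      unfolding h_def h'_def
      by (auto intro!: derivative_eq_intros der simp: algebra_simps)
  qed (use zero in \<open>auto simp: h_def h'_def\<close>)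
  moreover have "(LINT x|lebesgue_on D. h' x) = (LINT x|lborel. h' x)"
  proof -
    have "(LINT x|lebesgue_on D. h' x) = (LINT x|lebesgue. indicator D x *\<^sub>R h' x)"
      using D(1) by (subst integral_restrict_space) auto
    also have "(\<lambda>x. indicator D x *\<^sub>R h' x) = h'"
      using zero by (auto simp: fun_eq_iff indicator_def h'_def)
    also have "(LINT x|lebesgue. h' x) = (LINT x|lborel. h' x)"
      using cont(2) by (intro integral_completion) (simp add: borel_measurable_continuous_onI)
    finally show ?thesis .
  qed
  ultimately have "(LINT x|lebesgue_on D. (f x)\<^sup>2) = - (LINT x|lebesgue_on D. f x * (2 * x $ i * f' x))"
    using L2_integrable_square[OF fL] L2_integrable_mult[OF fL gL] by (simp add: h'_def)
  then have "(l2norm D f)\<^sup>2 \<le> l2norm D f * l2norm D (\<lambda>x. 2 * x $ i * f' x)"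
    using L2_Cauchy_Schwarz[OF fL gL] by (simp add: l2norm_square)
  also have "l2norm D (\<lambda>x. 2 * x $ i * f' x) \<le> 2 * R * l2norm D f'"
  proof (rule power2_le_imp_le)
    have "(2 * x $ i * f' x)\<^sup>2 \<le> (2 * R)\<^sup>2 * (f' x)\<^sup>2" if "x \<in> D" for x
    proof -
      have "\<bar>x $ i\<bar> \<le> \<bar>R\<bar>" using D(2)[OF that] component_le_norm_cart[of x i] by linarith
      then have "(x $ i)\<^sup>2 \<le> R\<^sup>2" by (simp add: abs_le_square_iff)
      then show ?thesis by (simp add: power_mult_distrib mult_right_mono)
    qed
    then have "(LINT x|lebesgue_on D. (2 * x $ i * f' x)\<^sup>2)
        \<le> (LINT x|lebesgue_on D. (2 * R)\<^sup>2 * (f' x)\<^sup>2)"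
      using L2_integrable_square[OF gL] L2_integrable_square[OF f'L]
      by (intro integral_mono) auto
    then show "(l2norm D (\<lambda>x. 2 * x $ i * f' x))\<^sup>2 \<le> (2 * R * l2norm D f')\<^sup>2"
      by (simp add: power_mult_distrib l2norm_square)
  qed (use R l2norm_nonneg[of D f'] in simp)
  finally have "l2norm D f * l2norm D f \<le> l2norm D f * (2 * R * l2norm D f')"
    by (simp add: power2_eq_square l2norm_nonneg mult_left_mono)
  then show ?thesis
    using R l2norm_nonneg[of D f] l2norm_nonneg[of D f']
    by (intro le_of_mult_self_le[of "l2norm D f"]) (auto simp: mult.commute)
qed

section \<open>Lipschitz continuity of the Dirichlet inverse\<close>

lemma test_functionD:
  assumes "test_function D \<phi>"
  shows "\<phi> differentiable (at y)" "continuous_on UNIV \<phi>" "continuous_on UNIV (partial_deriv i \<phi>)"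
    and "y \<notin> D \<Longrightarrow> \<phi> y = 0"
proof -
  have "Ck 1 \<phi>" using assms by (simp add: test_function_def smooth_def del: One_nat_def)
  then show *: "\<phi> differentiable (at y)" "continuous_on UNIV (partial_deriv i \<phi>)" for y
    by auto
  then show "continuous_on UNIV \<phi>"
    by (simp add: continuous_on_eq_continuous_at differentiable_imp_continuous_within)
  show "y \<notin> D \<Longrightarrow> \<phi> y = 0"
    using assms closure_subset[of "{y. \<phi> y \<noteq> 0}"] by (auto simp: test_function_def)
qed

lemma has_real_derivative_partial_deriv:
  fixes f :: "real^'n::finite \<Rightarrow> real"
  assumes "f differentiable (at y)"
  shows "((\<lambda>t. f (y + t *\<^sub>R axis i 1)) has_real_derivative partial_deriv i f y) (at 0)"
proof -
  let ?F = "frechet_derivative f (at y)"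
  have F: "(f has_derivative ?F) (at (y + 0 *\<^sub>R axis i 1))"
    using assms by (simp add: frechet_derivative_works)
  have "((\<lambda>t. y + t *\<^sub>R axis i 1) has_derivative (\<lambda>t. t *\<^sub>R axis i 1)) (at 0)"
    by (auto intro!: derivative_eq_intros)
  from diff_chain_at[OF this F]
  have "((\<lambda>t. f (y + t *\<^sub>R axis i 1)) has_derivative (\<lambda>t. ?F (t *\<^sub>R axis i 1))) (at 0)"
    by (simp add: o_def)
  moreover have "?F (t *\<^sub>R axis i 1) = partial_deriv i f y * t" for t
    using linear_cmul[OF linear_frechet_derivative[OF assms], of t "axis i 1"]
    by (simp add: partial_deriv_def)
  ultimately show ?thesis by (simp add: has_field_derivative_def)
qed

text \<open>
  The inequality is stated for a difference of two test functions because it is applied to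
  \<open>K v - K w\<close>, with separate approximating sequences for \<open>K v\<close> and \<open>K w\<close>.
\<close>

lemma Poincare_test_functions:
  assumes \<phi>: "test_function D \<phi>" and \<psi>: "test_function D \<psi>"
    and D: "open D" "\<And>y. y \<in> D \<Longrightarrow> norm y \<le> R" "D \<noteq> {}"
  shows "l2dist D \<phi> \<psi> \<le> 2 * R * l2dist D (partial_deriv i \<phi>) (partial_deriv i \<psi>)"
  unfolding l2dist_def
proof (rule Poincare_inequality[OF _ _ _ D])
  show "((\<lambda>t. \<phi> (y + t *\<^sub>R axis i 1) - \<psi> (y + t *\<^sub>R axis i 1)) has_real_derivative
      partial_deriv i \<phi> y - partial_deriv i \<psi> y) (at 0)" for y
    by (intro DERIV_diff has_real_derivative_partial_deriv test_functionD(1)[OF \<phi>]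
        test_functionD(1)[OF \<psi>])
qed (auto intro!: continuous_on_diff test_functionD(2,3)[OF \<phi>] test_functionD(2,3)[OF \<psi>]
    simp: test_functionD(4)[OF \<phi>] test_functionD(4)[OF \<psi>])

lemma in_H1D:
  assumes "in_H1 D w G"
  shows "w \<in> L2 D" "(\<lambda>y. G y $ i) \<in> L2 D"
  using assms by (auto simp: in_H1_def)

lemma Poincare_H10:
  assumes "in_H10 D w G" "in_H10 D z H"
    and D: "open D" "\<And>y. y \<in> D \<Longrightarrow> norm y \<le> R" "D \<noteq> {}"
  shows "l2dist D w z \<le> 2 * R * l2dist D (\<lambda>y. G y $ i) (\<lambda>y. H y $ i)"
proof -
  obtain \<phi> \<psi> where \<phi>: "\<And>k. test_function D (\<phi> k)" "H1_approx D \<phi> w G"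
    and \<psi>: "\<And>k. test_function D (\<psi> k)" "H1_approx D \<psi> z H"
    using assms(1,2) by (auto simp: in_H10_def)
  have wz: "in_H1 D w G" "in_H1 D z H" using assms(1,2) by (auto simp: in_H10_def)
  have bd: "bounded D" using D(2) by (auto simp: bounded_iff)
  note L = continuous_in_L2[OF _ bd D(1)]
  show ?thesis
  proof (rule LIMSEQ_le)
    show "(\<lambda>k. l2dist D (\<phi> k) (\<psi> k)) \<longlonglongrightarrow> l2dist D w z"
      using \<phi>(2) \<psi>(2) unfolding H1_approx_def
      by (intro tendsto_l2dist L test_functionD(2)[OF \<phi>(1)] test_functionD(2)[OF \<psi>(1)] in_H1D(1)[OF wz(1)] in_H1D(1)[OF wz(2)]) auto
    show "(\<lambda>k. 2 * R * l2dist D (partial_deriv i (\<phi> k)) (partial_deriv i (\<psi> k)))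
        \<longlonglongrightarrow> 2 * R * l2dist D (\<lambda>y. G y $ i) (\<lambda>y. H y $ i)"
      using \<phi>(2) \<psi>(2) unfolding H1_approx_def
      by (intro tendsto_mult_left tendsto_l2dist L test_functionD(3)[OF \<phi>(1)] test_functionD(3)[OF \<psi>(1)] in_H1D(2)[OF wz(1)] in_H1D(2)[OF wz(2)]) auto
    show "\<exists>n. \<forall>k\<ge>n. l2dist D (\<phi> k) (\<psi> k)
        \<le> 2 * R * l2dist D (partial_deriv i (\<phi> k)) (partial_deriv i (\<psi> k))"
      using Poincare_test_functions[OF \<phi>(1) \<psi>(1) D] by blast
  qed
qed

lemma integral_L2_inner:
  fixes D :: "(real^'n::finite) set"
  assumes "\<And>i. (\<lambda>y. a y * G y $ i) \<in> L2 D" "\<And>i. (\<lambda>y. H y $ i) \<in> L2 D"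
  shows "integrable (lebesgue_on D) (\<lambda>y. a y * (G y \<bullet> H y))"
    and "(LINT y|lebesgue_on D. a y * (G y \<bullet> H y)) = (\<Sum>i\<in>UNIV. LINT y|lebesgue_on D. a y * G y $ i * H y $ i)"
  using L2_integrable_mult[OF assms]
  by (simp_all add: inner_vec_def sum_distrib_left mult.assoc)

text \<open>
  Elements of \<open>H\<^sup>1\<^sub>0(D)\<close> may be used as test functions, since both sides are continuous in the
  \<open>H\<^sup>1\<close> norm.
\<close>

lemma elliptic_eq_H10:
  fixes D :: "(real^'n::finite) set"
  assumes eq: "elliptic_eq D \<mu> G f" and f: "f \<in> L2 D"
    and G: "\<And>i. (\<lambda>y. \<mu> y * G y $ i) \<in> L2 D"
    and z: "in_H10 D z H" and D: "bounded D" "open D"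
  shows "(LINT y|lebesgue_on D. \<mu> y * (G y \<bullet> H y)) = (LINT y|lebesgue_on D. f y * z y)"
proof -
  obtain \<phi> where \<phi>: "\<And>k. test_function D (\<phi> k)" "H1_approx D \<phi> z H"
    using z by (auto simp: in_H10_def)
  have z1: "in_H1 D z H" using z by (simp add: in_H10_def)
  note L = continuous_in_L2[OF _ D]
  have \<phi>L: "\<phi> k \<in> L2 D" "partial_deriv i (\<phi> k) \<in> L2 D" for k i
    by (intro L test_functionD(2,3)[OF \<phi>(1)])+
  have "(\<lambda>k. LINT y|lebesgue_on D. f y * \<phi> k y) \<longlonglongrightarrow> (LINT y|lebesgue_on D. f y * z y)"
    using \<phi>(2) by (intro tendsto_integral_mult_L2 f \<phi>L in_H1D(1)[OF z1]) (simp add: H1_approx_def)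
  moreover have "(\<lambda>k. LINT y|lebesgue_on D. f y * \<phi> k y) \<longlonglongrightarrow> (LINT y|lebesgue_on D. \<mu> y * (G y \<bullet> H y))"
  proof -
    have "(LINT y|lebesgue_on D. f y * \<phi> k y)
        = (\<Sum>i\<in>UNIV. LINT y|lebesgue_on D. \<mu> y * G y $ i * partial_deriv i (\<phi> k) y)" for k
    proof -
      have "(LINT y|lebesgue_on D. f y * \<phi> k y) = (LINT y|lebesgue_on D. \<mu> y * (G y \<bullet> grad (\<phi> k) y))"
        using eq \<phi>(1) by (simp add: elliptic_eq_def)
      also have "\<dots> = (\<Sum>i\<in>UNIV. LINT y|lebesgue_on D. \<mu> y * G y $ i * partial_deriv i (\<phi> k) y)"
        using integral_L2_inner(2)[of \<mu> G D "grad (\<phi> k)"] G \<phi>L(2) by (simp add: grad_def)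
      finally show ?thesis .
    qed
    moreover have "(\<lambda>k. \<Sum>i\<in>UNIV. LINT y|lebesgue_on D. \<mu> y * G y $ i * partial_deriv i (\<phi> k) y)
        \<longlonglongrightarrow> (\<Sum>i\<in>UNIV. LINT y|lebesgue_on D. \<mu> y * G y $ i * H y $ i)"
      using \<phi>(2) by (intro tendsto_sum tendsto_integral_mult_L2 G \<phi>L in_H1D(2)[OF z1])
        (simp add: H1_approx_def)
    ultimately show ?thesis
      using integral_L2_inner(2)[of \<mu> G D H] G in_H1D(2)[OF z1] by simp
  qed
  ultimately show ?thesis by (rule LIMSEQ_unique[symmetric])
qed

text \<open>
  Testing the equation for \<open>d = K v - K w\<close> with \<open>d\<close> itself gives
  \<open>\<mu>_min \<parallel>\<partial>\<^sub>i d\<parallel>\<^sup>2 \<le> \<parallel>v - w\<parallel> \<parallel>d\<parallel>\<close> for any one index \<open>i\<close>, and \<open>\<parallel>d\<parallel> \<le> 2 R \<parallel>\<partial>\<^sub>i d\<parallel>\<close> by Poincare.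
  Hence \<open>\<parallel>d\<parallel> \<le> (2 R)\<^sup>2 / \<mu>_min \<parallel>v - w\<parallel>\<close>. The equation determines \<open>K v\<close> only up to
  null sets, so \<open>K\<close> need not be linear as a map of functions, and two of its values are compared
  directly.
\<close>

lemma dirichlet_inverse_L2_lipschitz:
  fixes D :: "(real^'n::finite) set"
  assumes D: "bounded D" "open D" "D \<noteq> {}"
    and \<mu>: "continuous_on (closure D) \<mu>" "0 < \<mu>_min" "\<And>y. y \<in> D \<Longrightarrow> \<mu>_min \<le> \<mu> y"
    and K: "dirichlet_inverse D \<mu> K"
  obtains C where "0 \<le> C" "\<And>v w. v \<in> L2 D \<Longrightarrow> w \<in> L2 D \<Longrightarrow> l2dist D (K v) (K w) \<le> C * l2dist D v w"
proof -
  obtain R where R: "\<And>y. y \<in> D \<Longrightarrow> norm y \<le> R"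
    using D(1) by (auto simp: bounded_iff)
  have mu_meas: "\<mu> \<in> borel_measurable (lebesgue_on D)"
    using D(2) by (intro continuous_imp_measurable_on_sets_lebesgue
        continuous_on_subset[OF \<mu>(1)]) (auto simp: closure_subset)
  obtain B where B: "\<And>y. y \<in> D \<Longrightarrow> \<bar>\<mu> y\<bar> \<le> B"
  proof -
    have "compact (\<mu> ` closure D)" using D(1) \<mu>(1) by (intro compact_continuous_image) auto
    then show ?thesis
      using that closure_subset[of D] by (fastforce dest!: compact_imp_bounded simp: bounded_iff)
  qed
  let ?C = "(2 * R)\<^sup>2 / \<mu>_min"
  show ?thesis
  proof
    show "0 \<le> ?C" using \<mu>(2) by simp
    fix v w assume v: "v \<in> L2 D" and w: "w \<in> L2 D"
    obtain G H where G: "in_H10 D (K v) G" "elliptic_eq D \<mu> G v"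
      and H: "in_H10 D (K w) H" "elliptic_eq D \<mu> H w"
      using K v w unfolding dirichlet_inverse_def by blast
    have G1: "in_H1 D (K v) G" and H1: "in_H1 D (K w) H"
      using G H by (auto simp: in_H10_def)
    have muL: "(\<lambda>y. \<mu> y * F y $ i) \<in> L2 D" if "in_H1 D z F" for z F i
      using L2_bounded_mult[OF mu_meas B in_H1D(2)[OF that]] .
    let ?d = "\<lambda>y. K v y - K w y" and ?f = "\<lambda>y. v y - w y" and ?E = "\<lambda>y. G y - H y"
    have dL: "?d \<in> L2 D" and fL: "?f \<in> L2 D" and EL: "(\<lambda>y. ?E y $ i) \<in> L2 D" for i
      using L2_diff[OF v w] L2_diff[OF in_H1D(1)[OF G1] in_H1D(1)[OF H1]]
        L2_diff[OF in_H1D(2)[OF G1] in_H1D(2)[OF H1]] by auto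
    have muE: "(\<lambda>y. \<mu> y * ?E y $ i) \<in> L2 D" for i
      using L2_bounded_mult[OF mu_meas B EL] .
    \<comment> \<open>The Poincare inequality holds in every coordinate direction; an arbitrary one is fixed.\<close>
    define i :: 'n where "i = undefined"
    let ?n = "l2norm D (\<lambda>y. ?E y $ i)"
    \<comment> \<open>Expanding both factors reduces the energy of the difference to the four pairings of one
      equation with one solution.\<close>
    have energy: "(LINT y|lebesgue_on D. \<mu> y * (?E y \<bullet> ?E y)) = (LINT y|lebesgue_on D. ?f y * ?d y)"
    proof -
      note e = elliptic_eq_H10[OF _ _ _ _ D(1,2)]
      have "(LINT y|lebesgue_on D. \<mu> y * (?E y \<bullet> ?E y))
          = (LINT y|lebesgue_on D. \<mu> y * (G y \<bullet> G y) - \<mu> y * (G y \<bullet> H y)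
              - (\<mu> y * (H y \<bullet> G y) - \<mu> y * (H y \<bullet> H y)))"
        by (simp add: inner_diff_left inner_diff_right algebra_simps)
      also have "\<dots> = (LINT y|lebesgue_on D. v y * K v y) - (LINT y|lebesgue_on D. v y * K w y)
          - ((LINT y|lebesgue_on D. w y * K v y) - (LINT y|lebesgue_on D. w y * K w y))"
        using integral_L2_inner(1)[OF muL[OF G1] in_H1D(2)[OF G1]]
          integral_L2_inner(1)[OF muL[OF G1] in_H1D(2)[OF H1]]
          integral_L2_inner(1)[OF muL[OF H1] in_H1D(2)[OF G1]]
          integral_L2_inner(1)[OF muL[OF H1] in_H1D(2)[OF H1]]
        by (simp add: e[OF G(2) v muL[OF G1] G(1)] e[OF G(2) v muL[OF G1] H(1)]
            e[OF H(2) w muL[OF H1] G(1)] e[OF H(2) w muL[OF H1] H(1)])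
      also have "\<dots> = (LINT y|lebesgue_on D. v y * K v y - v y * K w y - (w y * K v y - w y * K w y))"
        using L2_integrable_mult[OF v in_H1D(1)[OF G1]] L2_integrable_mult[OF v in_H1D(1)[OF H1]]
          L2_integrable_mult[OF w in_H1D(1)[OF G1]] L2_integrable_mult[OF w in_H1D(1)[OF H1]]
        by simp
      finally show ?thesis by (simp add: algebra_simps)
    qed
    have "\<mu>_min * ?n\<^sup>2 = (LINT y|lebesgue_on D. \<mu>_min * (?E y $ i)\<^sup>2)"
      by (simp add: l2norm_square)
    also have "\<dots> \<le> (LINT y|lebesgue_on D. \<mu> y * (?E y \<bullet> ?E y))"
    proof (rule integral_mono)
      show "integrable (lebesgue_on D) (\<lambda>y. \<mu>_min * (?E y $ i)\<^sup>2)"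
        using L2_integrable_square[OF EL[of i]] by simp
      show "integrable (lebesgue_on D) (\<lambda>y. \<mu> y * (?E y \<bullet> ?E y))"
        by (rule integral_L2_inner(1)[OF muE EL])
      fix y assume "y \<in> space (lebesgue_on D)"
      then have "\<mu>_min \<le> \<mu> y" using \<mu>(3) by simp
      moreover have "(?E y $ i)\<^sup>2 \<le> ?E y \<bullet> ?E y"
        using power_mono[OF component_le_norm_cart[of "?E y" i], of 2]
        by (simp add: power2_norm_eq_inner)
      ultimately show "\<mu>_min * (?E y $ i)\<^sup>2 \<le> \<mu> y * (?E y \<bullet> ?E y)"
        using \<mu>(2) by (intro mult_mono) auto
    qed
    also have "\<dots> \<le> l2dist D v w * l2dist D (K v) (K w)"
      unfolding energy l2dist_def using L2_Cauchy_Schwarz[OF fL dL] by linarith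
    finally have n: "\<mu>_min * ?n\<^sup>2 \<le> l2dist D v w * l2dist D (K v) (K w)" .
    have "l2dist D (K v) (K w) \<le> 2 * R * ?n"
      using Poincare_H10[OF G(1) H(1) D(2) R D(3), of i] by (simp add: l2dist_def)
    then have "(l2dist D (K v) (K w))\<^sup>2 \<le> (2 * R)\<^sup>2 * ?n\<^sup>2"
      using power_mono[OF _ l2dist_nonneg, of D "K v" "K w" "2 * R * ?n" 2]
      by (simp add: power_mult_distrib)
    also have "\<dots> = ?C * (\<mu>_min * ?n\<^sup>2)" using \<mu>(2) by simp
    also have "\<dots> \<le> ?C * (l2dist D v w * l2dist D (K v) (K w))"
      using n \<mu>(2) by (intro mult_left_mono) auto
    finally have "l2dist D (K v) (K w) * l2dist D (K v) (K w)
        \<le> (?C * l2dist D v w) * l2dist D (K v) (K w)"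
      by (simp add: power2_eq_square mult_ac)
    then show "l2dist D (K v) (K w) \<le> ?C * l2dist D v w"
      by (rule le_of_mult_self_le[OF l2dist_nonneg mult_nonneg_nonneg[OF \<open>0 \<le> ?C\<close> l2dist_nonneg]])
  qed
qed

section \<open>Lipschitz continuity of the nonlinear map\<close>

text \<open>
  Pointwise, \<open>e(v) - e(w) = ((v - w) - e(w) (K v - K w)) / u(v)\<close>, where the denominator is at least \<open>m\<close>
  and \<open>\<bar>e(w)\<bar> \<le> M\<close>. The constant depends on \<open>m\<close>, \<open>M\<close> and the bound for \<open>K\<close> only, so it is the same
  for all \<open>v\<close> in \<open>V\<^sub>\<star>\<close>.
\<close>

lemma e_of_L2_lipschitz:
  fixes D :: "(real^'n::finite) set"
  assumes KL: "\<And>v w. v \<in> L2 D \<Longrightarrow> w \<in> L2 D \<Longrightarrow> l2dist D (K v) (K w) \<le> C * l2dist D v w"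
    and KL2: "\<And>v. v \<in> L2 D \<Longrightarrow> K v \<in> L2 D"
    and C: "0 \<le> C" and m: "0 < m"
    and v: "v \<in> L2 D" "AE y in lebesgue_on D. m \<le> u_of K gt v y"
    and w: "w \<in> L2 D" "AE y in lebesgue_on D. m \<le> u_of K gt w y"
      "AE y in lebesgue_on D. \<bar>e_of K gt w y\<bar> \<le> M"
  shows "l2dist D (e_of K gt v) (e_of K gt w) \<le> sqrt 2 / m * (1 + \<bar>M\<bar> * C) * l2dist D v w"
proof -
  have "AE y in lebesgue_on D. (e_of K gt v y - e_of K gt w y)\<^sup>2
      \<le> 2 / m\<^sup>2 * ((v y - w y)\<^sup>2 + M\<^sup>2 * (K v y - K w y)\<^sup>2)"
    using v(2) w(2,3)
  proof eventually_elim
    case (elim y)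
    let ?p = "v y - w y" and ?q = "e_of K gt w y * (K v y - K w y)" and ?u = "u_of K gt v y"
    have "e_of K gt v y - e_of K gt w y = (?p - ?q) / ?u"
      using elim m by (simp add: e_of_def divide_simps) (simp add: u_of_def algebra_simps)
    then have "(e_of K gt v y - e_of K gt w y)\<^sup>2 = (?p - ?q)\<^sup>2 / ?u\<^sup>2"
      by (simp add: power_divide)
    also have "\<dots> \<le> (?p - ?q)\<^sup>2 / m\<^sup>2"
      using elim m by (intro divide_left_mono power_mono) auto
    also have "(?p - ?q)\<^sup>2 \<le> 2 * (?p\<^sup>2 + ?q\<^sup>2)"
      using zero_le_power2[of "?p + ?q"] by (simp add: power2_sum power2_diff)
    also have "?q\<^sup>2 \<le> M\<^sup>2 * (K v y - K w y)\<^sup>2"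
    proof -
      have "(e_of K gt w y)\<^sup>2 \<le> M\<^sup>2" using elim by (simp add: abs_le_square_iff[symmetric])
      then show ?thesis by (simp add: power_mult_distrib mult_right_mono)
    qed
    finally show ?case using m by (simp add: divide_right_mono)
  qed
  note * = integral_mono_AE'[OF _ this]
  have i: "integrable (lebesgue_on D) (\<lambda>y. (v y - w y)\<^sup>2)"
    "integrable (lebesgue_on D) (\<lambda>y. (K v y - K w y)\<^sup>2)"
    using L2_integrable_square[OF L2_diff[OF v(1) w(1)]]
      L2_integrable_square[OF L2_diff[OF KL2[OF v(1)] KL2[OF w(1)]]] by auto
  have "(l2dist D (e_of K gt v) (e_of K gt w))\<^sup>2
      \<le> (LINT y|lebesgue_on D. 2 / m\<^sup>2 * ((v y - w y)\<^sup>2 + M\<^sup>2 * (K v y - K w y)\<^sup>2))"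
    unfolding l2dist_def l2norm_square using i by (intro *) auto
  also have "\<dots> = 2 / m\<^sup>2 * ((l2dist D v w)\<^sup>2 + M\<^sup>2 * (l2dist D (K v) (K w))\<^sup>2)"
    using i by (simp add: l2dist_def l2norm_square)
  also have "\<dots> \<le> 2 / m\<^sup>2 * ((l2dist D v w)\<^sup>2 + M\<^sup>2 * (C * l2dist D v w)\<^sup>2)"
    using KL[OF v(1) w(1)] l2dist_nonneg
    by (intro mult_left_mono add_left_mono power_mono) auto
  also have "\<dots> = 2 / m\<^sup>2 * ((1 + (\<bar>M\<bar> * C)\<^sup>2) * (l2dist D v w)\<^sup>2)"
    by (simp add: power_mult_distrib algebra_simps)
  also have "\<dots> \<le> 2 / m\<^sup>2 * ((1 + \<bar>M\<bar> * C)\<^sup>2 * (l2dist D v w)\<^sup>2)"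
    using C by (intro mult_left_mono mult_right_mono) (auto simp: power2_sum)
  also have "\<dots> = (sqrt 2 / m * (1 + \<bar>M\<bar> * C) * l2dist D v w)\<^sup>2"
    by (simp add: power_mult_distrib power_divide)
  finally show ?thesis
    by (rule power2_le_imp_le) (use C m l2dist_nonneg[of D v w] in \<open>simp add: zero_le_mult_iff zero_le_divide_iff\<close>)
qed

section \<open>Measurability of point values\<close>

lemma space_L2_borel: "space (L2_borel D) = L2 D"
  by (simp add: L2_borel_def space_measure_of_conv)

lemma sets_L2_borelI: "L2_open D U \<Longrightarrow> U \<in> sets (L2_borel D)"
  unfolding L2_borel_def by (subst sets_measure_of) (auto simp: L2_open_def)

lemma borel_measurable_L2_lipschitz:
  assumes "0 \<le> C" and lip: "\<And>v w. v \<in> L2 D \<Longrightarrow> w \<in> L2 D \<Longrightarrow> \<bar>F v - F w\<bar> \<le> C * l2dist D v w"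
  shows "F \<in> borel_measurable (L2_borel D)"
proof (rule borel_measurableI)
  fix S :: "real set" assume S: "open S"
  have "L2_open D {v \<in> L2 D. F v \<in> S}"
    unfolding L2_open_def
  proof safe
    fix v assume v: "v \<in> L2 D" "F v \<in> S"
    then obtain e where e: "e > 0" "ball (F v) e \<subseteq> S"
      using S open_contains_ball by blast
    have "F h \<in> S" if h: "h \<in> L2 D" "l2dist D h v < e / (C + 1)" for h
    proof -
      have "\<bar>F h - F v\<bar> \<le> C * l2dist D h v" by (rule lip[OF h(1) v(1)])
      also have "\<dots> \<le> C * (e / (C + 1))" using h(2) assms(1) by (intro mult_left_mono) auto
      also have "\<dots> < e" using e assms(1) by (simp add: field_simps)
      finally show ?thesis using e(2) by (auto simp: subset_eq dist_real_def abs_minus_commute)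
    qed
    then show "\<exists>r>0. {h \<in> L2 D. l2dist D h v < r} \<subseteq> {v \<in> L2 D. F v \<in> S}"
      using e(1) assms(1) by (intro exI[of _ "e / (C + 1)"]) auto
  qed
  then have "{v \<in> L2 D. F v \<in> S} \<in> sets (L2_borel D)" by (rule sets_L2_borelI)
  then show "F -` S \<inter> space (L2_borel D) \<in> sets (L2_borel D)"
    by (simp add: space_L2_borel vimage_def Int_def conj_commute)
qed

lemma borel_measurable_l2dist:
  assumes "k \<in> L2 D"
  shows "(\<lambda>v. l2dist D v k) \<in> borel_measurable (L2_borel D)"
  by (rule borel_measurable_L2_lipschitz[of 1]) (simp_all add: abs_l2dist_diff_le assms)

text \<open>
  The quotient whose limit as \<open>r\<close> tends to \<open>0\<close> defines \<open>point_value\<close>.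
\<close>

definition ball_average :: "(real^'n::finite) set \<Rightarrow> real^'n \<Rightarrow> (real^'n \<Rightarrow> real) \<Rightarrow> real \<Rightarrow> real" where
  "ball_average D z v r =
     (LINT y|lebesgue_on (D \<inter> ball z r). v y) / measure lebesgue (D \<inter> ball z r)"

lemma point_value_ball_average:
  "point_value D v z =
     (if \<exists>l. (ball_average D z v \<longlongrightarrow> l) (at_right 0) then Lim (at_right 0) (ball_average D z v) else 0)"
  unfolding point_value_def ball_average_def[abs_def] by (simp add: Let_def)

text \<open>
  For fixed radius, averaging is a bounded linear functional on \<open>L\<^sup>2(D)\<close>.
\<close>

lemma borel_measurable_ball_average:
  fixes D :: "(real^'n::finite) set"
  assumes D: "bounded D" "open D"
  shows "(\<lambda>v. ball_average D z v r) \<in> borel_measurable (L2_borel D)"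
proof -
  let ?I = "\<lambda>y. indicator (ball z r) y :: real"
  have I: "?I \<in> L2 D"
  proof -
    have "?I \<in> borel_measurable (lebesgue_on D)"
      by (rule measurable_restrict_space1[OF borel_measurable_indicator]) simp
    from L2_bounded_mult[OF this _ continuous_in_L2[OF _ D, of "\<lambda>_. 1"], of 1] show ?thesis
      by simp
  qed
  have eq: "(LINT y|lebesgue_on (D \<inter> ball z r). v y) = (LINT y|lebesgue_on D. ?I y * v y)" for v
    using D by (simp add: integral_restrict_space indicator_inter_arith mult_ac)
  have "\<bar>(LINT y|lebesgue_on D. ?I y * v y) - (LINT y|lebesgue_on D. ?I y * w y)\<bar>
      \<le> l2norm D ?I * l2dist D v w" if "v \<in> L2 D" "w \<in> L2 D" for v w
  proof -
    have "(LINT y|lebesgue_on D. ?I y * v y) - (LINT y|lebesgue_on D. ?I y * w y)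
        = (LINT y|lebesgue_on D. ?I y * (v y - w y))"
      using L2_integrable_mult[OF I that(1)] L2_integrable_mult[OF I that(2)]
      by (simp add: right_diff_distrib)
    then show ?thesis
      using L2_Cauchy_Schwarz[OF I L2_diff[OF that]] by (simp add: l2dist_def)
  qed
  then have "(\<lambda>v. LINT y|lebesgue_on D. ?I y * v y) \<in> borel_measurable (L2_borel D)"
    by (rule borel_measurable_L2_lipschitz[OF l2norm_nonneg])
  then show ?thesis by (simp add: ball_average_def eq)
qed

text \<open>
  Open balls of radii increasing to \<open>r\<close> exhaust the open ball of radius \<open>r\<close>. This one-sided continuity
  makes rational radii sufficient in the definition of point values.
\<close>

lemma ball_average_left_continuous:
  fixes D :: "(real^'n::finite) set"
  assumes D: "bounded D" "open D" "z \<in> D" and v: "v \<in> L2 D" and r: "0 < r"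
  shows "(ball_average D z v \<longlongrightarrow> ball_average D z v r) (at_left r)"
proof -
  have one: "(\<lambda>_. 1) \<in> L2 D" by (rule continuous_in_L2[OF _ D(1,2)]) simp
  have I: "((\<lambda>r. LINT y|lebesgue_on (D \<inter> ball z r). f y)
      \<longlongrightarrow> (LINT y|lebesgue_on (D \<inter> ball z r). f y)) (at_left r)" if f: "f \<in> L2 D" for f
  proof (rule tendsto_at_left_sequentially[of 0])
    fix S :: "nat \<Rightarrow> real"
    assume S: "\<And>n. S n < r" "incseq S" "S \<longlonglongrightarrow> r"
    have un: "(\<Union>n. D \<inter> ball z (S n)) = D \<inter> ball z r"
    proof (intro equalityI subsetI)
      fix y assume y: "y \<in> D \<inter> ball z r"
      then have "\<forall>\<^sub>F n in sequentially. dist z y < S n"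
        using order_tendstoD(1)[OF S(3)] by auto
      then show "y \<in> (\<Union>n. D \<inter> ball z (S n))"
        using y eventually_happens'[OF sequentially_bot] by fastforce
    qed (use S(1) in \<open>auto intro: less_trans\<close>)
    have "integrable (lebesgue_on D) f"
      using L2_integrable_mult[OF one f] by simp
    then have "set_integrable lebesgue D f"
      using D(2) by (simp add: set_integrable_def integrable_restrict_space)
    then have "set_integrable lebesgue (D \<inter> ball z r) f"
      by (rule set_integrable_subset) (use D(2) in auto)
    then have "(\<lambda>n. LINT y:D \<inter> ball z (S n)|lebesgue. f y) \<longlonglongrightarrow> (LINT y:D \<inter> ball z r|lebesgue. f y)"
      unfolding un[symmetric] using D(2) S(2)
      by (intro set_integral_cont_up) (force simp: incseq_def)+
    then show "(\<lambda>n. LINT y|lebesgue_on (D \<inter> ball z (S n)). f y)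
        \<longlonglongrightarrow> (LINT y|lebesgue_on (D \<inter> ball z r). f y)"
      using D(2) by (simp add: set_lebesgue_integral_def integral_restrict_space)
  qed (rule r)
  have "((\<lambda>r. measure lebesgue (D \<inter> ball z r)) \<longlongrightarrow> measure lebesgue (D \<inter> ball z r)) (at_left r)"
    using I[OF one] D(2) by (simp add: measure_restrict_space)
  moreover have "measure lebesgue (D \<inter> ball z r) \<noteq> 0"
  proof -
    have "\<not> negligible (D \<inter> ball z r)"
      using D(2,3) r by (intro open_not_negligible) auto
    then show ?thesis
      using D(2) lmeasurable_open[of "D \<inter> ball z r"] D(1) by (subst negligible_iff_measure0[symmetric]) auto
  qed
  ultimately show ?thesis
    unfolding ball_average_def using I[OF v] by (intro tendsto_divide)
qed

lemma left_continuous_in_closed: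
  fixes f :: "real \<Rightarrow> 'a::topological_space"
  assumes cont: "(f \<longlongrightarrow> f r) (at_left r)" and C: "closed C"
    and rat: "\<And>q. 0 < real_of_rat q \<Longrightarrow> real_of_rat q < b \<Longrightarrow> f (real_of_rat q) \<in> C"
    and r: "0 < r" "r < b"
  shows "f r \<in> C"
proof (rule ccontr)
  assume "f r \<notin> C"
  then have "\<forall>\<^sub>F s in at_left r. f s \<in> - C"
    using topological_tendstoD[OF cont, of "- C"] C by (simp add: open_Compl)
  then obtain a where a: "a < r" "\<And>s. a < s \<Longrightarrow> s < r \<Longrightarrow> f s \<in> - C"
    by (auto simp: eventually_at_left_field)
  obtain q where "max a 0 < real_of_rat q" "real_of_rat q < r"
    using of_rat_dense[of "max a 0" r] a(1) r(1) by auto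
  then show False using a(2)[of "real_of_rat q"] rat[of q] r(2) by simp
qed

text \<open>
  The existence of a limit over the uncountable set of radii becomes a countable combination of
  conditions, each of which is measurable when \<open>f\<close> depends measurably on a parameter.
\<close>

lemma convergent_at_right_iff_rational_Cauchy:
  fixes f :: "real \<Rightarrow> real"
  assumes cont: "\<And>r. 0 < r \<Longrightarrow> (f \<longlongrightarrow> f r) (at_left r)"
  shows "(\<exists>l. (f \<longlongrightarrow> l) (at_right 0)) \<longleftrightarrow>
    (\<forall>k::nat. \<exists>n::nat. \<forall>p q::rat. 0 < real_of_rat p \<and> real_of_rat p < inverse (real (Suc n)) \<and>
       0 < real_of_rat q \<and> real_of_rat q < inverse (real (Suc n)) \<longrightarrow>
       dist (f (real_of_rat p)) (f (real_of_rat q)) \<le> inverse (real (Suc k)))" (is "?L \<longleftrightarrow> ?R")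
proof
  assume ?L
  then obtain l where l: "(f \<longlongrightarrow> l) (at_right 0)" by blast
  show ?R
  proof
    fix k :: nat
    have "\<forall>\<^sub>F r in at_right 0. dist (f r) l < inverse (real (Suc k)) / 2"
      using l by (rule tendstoD) simp
    then obtain b where b: "b > 0" "\<And>r. 0 < r \<Longrightarrow> r < b \<Longrightarrow> dist (f r) l < inverse (real (Suc k)) / 2"
      by (auto simp: eventually_at_right_field)
    obtain n where n: "inverse (real (Suc n)) < b" using reals_Archimedean[OF b(1)] by blast
    have "dist (f p) (f q) \<le> inverse (real (Suc k))"
      if "0 < p" "p < inverse (real (Suc n))" "0 < q" "q < inverse (real (Suc n))" for p q
      using dist_triangle_half_r[of l "f p" "inverse (real (Suc k))" "f q"] b(2)[of p] b(2)[of q] that n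
      by (simp add: dist_commute)
    then show "\<exists>n. \<forall>p q. 0 < real_of_rat p \<and> real_of_rat p < inverse (real (Suc n)) \<and>
       0 < real_of_rat q \<and> real_of_rat q < inverse (real (Suc n)) \<longrightarrow>
       dist (f (real_of_rat p)) (f (real_of_rat q)) \<le> inverse (real (Suc k))"
      by blast
  qed
next
  assume R: ?R
  have cau: "\<exists>n::nat. \<forall>r s. 0 < r \<and> r < inverse (real (Suc n)) \<and> 0 < s \<and> s < inverse (real (Suc n)) \<longrightarrow>
      dist (f r) (f s) \<le> inverse (real (Suc k))" for k
  proof -
    let ?c = "inverse (real (Suc k))"
    obtain n where n: "\<And>p q. 0 < real_of_rat p \<Longrightarrow> real_of_rat p < inverse (real (Suc n)) \<Longrightarrow>
       0 < real_of_rat q \<Longrightarrow> real_of_rat q < inverse (real (Suc n)) \<Longrightarrow>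
       dist (f (real_of_rat p)) (f (real_of_rat q)) \<le> ?c"
      using R by blast
    let ?b = "inverse (real (Suc n))"
    \<comment> \<open>The bound passes from rational to real radii in one variable at a time.\<close>
    have 1: "f r \<in> cball (f (real_of_rat p)) ?c"
      if "0 < real_of_rat p" "real_of_rat p < ?b" "0 < r" "r < ?b" for p r
      by (rule left_continuous_in_closed[OF cont[OF that(3)] closed_cball _ that(3,4)])
        (use n that in auto)
    have "f s \<in> cball (f r) ?c" if "0 < r" "r < ?b" "0 < s" "s < ?b" for r s
      by (rule left_continuous_in_closed[OF cont[OF that(3)] closed_cball _ that(3,4)])
        (use 1 that in \<open>auto simp: dist_commute\<close>)
    then show ?thesis by (auto simp del: of_nat_Suc)
  qed
  have "Cauchy (\<lambda>j. f (inverse (real (Suc j))))"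
  proof (rule CauchyI')
    fix e :: real assume "e > 0"
    then obtain k where k: "inverse (real (Suc k)) < e" using reals_Archimedean by blast
    obtain n :: nat where n: "\<forall>r s. 0 < r \<and> r < inverse (real (Suc n)) \<and> 0 < s \<and> s < inverse (real (Suc n)) \<longrightarrow>
      dist (f r) (f s) \<le> inverse (real (Suc k))" using cau by blast
    have "inverse (real (Suc j)) < inverse (real (Suc n))" if "j > n" for j
      using that by (intro less_imp_inverse_less) auto
    then have "dist (f (inverse (real (Suc i)))) (f (inverse (real (Suc j)))) < e" if "i \<ge> Suc n" "j > i" for i j
      using n[rule_format, of "inverse (real (Suc i))" "inverse (real (Suc j))"] k that
      by (simp del: of_nat_Suc)
    then show "\<exists>M. \<forall>m\<ge>M. \<forall>n>m. dist (f (inverse (real (Suc m)))) (f (inverse (real (Suc n)))) < e"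
      by blast
  qed
  then obtain l where l: "(\<lambda>j. f (inverse (real (Suc j)))) \<longlonglongrightarrow> l"
    using Cauchy_convergent_iff convergent_def by blast
  have "(f \<longlongrightarrow> l) (at_right 0)"
  proof (rule tendstoI)
    fix e :: real assume "e > 0"
    then obtain k where k: "inverse (real (Suc k)) < e" using reals_Archimedean by blast
    obtain n :: nat where n: "\<forall>r s. 0 < r \<and> r < inverse (real (Suc n)) \<and> 0 < s \<and> s < inverse (real (Suc n)) \<longrightarrow>
      dist (f r) (f s) \<le> inverse (real (Suc k))" using cau by blast
    have "dist (f r) l < e" if r: "0 < r" "r < inverse (real (Suc n))" for r
    proof -
      have "dist (f r) l \<le> inverse (real (Suc k))"
      proof (rule Lim_bounded)
        show "(\<lambda>j. dist (f r) (f (inverse (real (Suc j))))) \<longlonglongrightarrow> dist (f r) l"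
          by (intro tendsto_intros l)
        have "inverse (real (Suc j)) < inverse (real (Suc n))" if "j > n" for j
          using that by (intro less_imp_inverse_less) auto
        then show "\<forall>j\<ge>Suc n. dist (f r) (f (inverse (real (Suc j)))) \<le> inverse (real (Suc k))"
          using n r by (simp del: of_nat_Suc)
      qed
      then show ?thesis using k by simp
    qed
    then show "\<forall>\<^sub>F r in at_right 0. dist (f r) l < e"
      unfolding eventually_at_right_field
      by (intro exI[of _ "inverse (real (Suc n))"]) (simp del: of_nat_Suc)
  qed
  then show ?L ..
qed

lemma borel_measurable_point_value:
  fixes D :: "(real^'n::finite) set"
  assumes D: "bounded D" "open D" "z \<in> D"
  shows "(\<lambda>v. point_value D v z) \<in> borel_measurable (L2_borel D)"
proof -
  let ?P = "\<lambda>v. \<forall>k::nat. \<exists>n::nat. \<forall>p q::rat.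
       0 < real_of_rat p \<and> real_of_rat p < inverse (real (Suc n)) \<and>
       0 < real_of_rat q \<and> real_of_rat q < inverse (real (Suc n)) \<longrightarrow>
       dist (ball_average D z v (real_of_rat p)) (ball_average D z v (real_of_rat q)) \<le> inverse (real (Suc k))"
  note [measurable] = borel_measurable_ball_average[OF D(1,2)]
  have eq: "point_value D v z = (if ?P v then lim (\<lambda>j. ball_average D z v (inverse (real (Suc j)))) else 0)"
    if "v \<in> L2 D" for v
  proof -
    have "?P v \<longleftrightarrow> (\<exists>l. (ball_average D z v \<longlongrightarrow> l) (at_right 0))"
      by (rule convergent_at_right_iff_rational_Cauchy[symmetric]) (rule ball_average_left_continuous[OF D that])
    moreover have "Lim (at_right 0) (ball_average D z v) = lim (\<lambda>j. ball_average D z v (inverse (real (Suc j))))"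
      if l: "(ball_average D z v \<longlongrightarrow> l) (at_right 0)" for l
    proof -
      have "filterlim (\<lambda>j. inverse (real (Suc j))) (at_right 0) sequentially"
        unfolding filterlim_at using LIMSEQ_inverse_real_of_nat by auto
      then have "(\<lambda>j. ball_average D z v (inverse (real (Suc j)))) \<longlonglongrightarrow> l"
        by (rule filterlim_compose[OF l])
      then show ?thesis
        using tendsto_Lim[OF _ l] by (simp add: limI)
    qed
    ultimately show ?thesis
      unfolding point_value_ball_average by (auto simp del: of_nat_Suc)
  qed
  have "(\<lambda>v. if ?P v then lim (\<lambda>j. ball_average D z v (inverse (real (Suc j)))) else 0)
      \<in> borel_measurable (L2_borel D)"
    by measurable
  then show ?thesis
    using eq by (subst measurable_cong) (auto simp: space_L2_borel)
qed

section \<open>The posterior distribution as a Markov kernel\<close>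

lemma likelihood_pos: "0 < \<epsilon> \<Longrightarrow> 0 < likelihood D \<epsilon> N x v Y"
  by (simp add: likelihood_def prod_pos normal_density_pos)

lemma likelihood_le: "likelihood D \<epsilon> N x v Y \<le> (1 / sqrt (2 * pi * \<epsilon>\<^sup>2)) ^ N"
proof -
  have "likelihood D \<epsilon> N x v Y \<le> (\<Prod>i<N. 1 / sqrt (2 * pi * \<epsilon>\<^sup>2))"
    unfolding likelihood_def normal_density_def
    by (intro prod_mono) (auto intro!: mult_left_le divide_right_mono)
  then show ?thesis by simp
qed

text \<open>
  The standing assumptions that make \<open>posterior\<close> a Markov kernel from observations to parameters:
  under them the likelihood is jointly measurable, and the evidence is positive and finite.
\<close>

locale gaussian_posterior = prob_space Q for Q :: "(real^'n::finite \<Rightarrow> real) measure" +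
  fixes D :: "(real^'n) set" and \<epsilon> :: real and N :: nat and x :: "nat \<Rightarrow> real^'n"
  assumes D: "bounded D" "open D" and x: "\<And>i. i < N \<Longrightarrow> x i \<in> D"
    and pos: "0 < \<epsilon>" and sets_Q: "sets Q = sets (L2_borel D)"
begin

lemma borel_measurable_likelihood:
  assumes v: "v \<in> measurable S Q" and Y: "\<And>i. i < N \<Longrightarrow> (\<lambda>\<omega>. Y \<omega> i) \<in> borel_measurable S"
  shows "(\<lambda>\<omega>. likelihood D \<epsilon> N x (v \<omega>) (Y \<omega>)) \<in> borel_measurable S"
proof -
  have "(\<lambda>\<omega>. point_value D (v \<omega>) (x i)) \<in> borel_measurable S" if "i < N" for i
    using measurable_compose[OF v, of "\<lambda>v. point_value D v (x i)"]
      borel_measurable_point_value[OF D x[OF that]]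
    by (simp add: measurable_cong_sets[OF sets_Q refl])
  then show ?thesis
    unfolding likelihood_def normal_density_def
    using Y by (intro borel_measurable_prod) (auto intro!: borel_measurable_times borel_measurable_exp
        borel_measurable_divide borel_measurable_uminus borel_measurable_power borel_measurable_diff)
qed

lemma borel_measurable_likelihood_Q [measurable]:
  "(\<lambda>v. likelihood D \<epsilon> N x v Y) \<in> borel_measurable Q"
  by (rule borel_measurable_likelihood) auto

definition evidence :: "(nat \<Rightarrow> real) \<Rightarrow> ennreal" where
  "evidence Y = (\<integral>\<^sup>+w. ennreal (likelihood D \<epsilon> N x w Y) \<partial>Q)"

lemma evidence_nonzero: "evidence Y \<noteq> 0"
proof
  assume "evidence Y = 0"
  then have "AE v in Q. ennreal (likelihood D \<epsilon> N x v Y) = 0"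
    unfolding evidence_def by (subst (asm) nn_integral_0_iff_AE) auto
  then have "AE v in Q. False"
    by eventually_elim (simp add: ennreal_eq_0_iff linorder_not_le[THEN iffD2, OF likelihood_pos[OF pos]])
  then show False by (simp add: AE_False)
qed

lemma evidence_finite: "evidence Y < \<infinity>"
proof -
  have "evidence Y \<le> (\<integral>\<^sup>+w. ennreal ((1 / sqrt (2 * pi * \<epsilon>\<^sup>2)) ^ N) \<partial>Q)"
    unfolding evidence_def by (intro nn_integral_mono ennreal_leI likelihood_le)
  also have "\<dots> < \<infinity>" by (simp add: emeasure_space_1)
  finally show ?thesis .
qed

lemma sets_posterior [simp, measurable_cong]: "sets (posterior D \<epsilon> N x Q Y) = sets Q"
  and space_posterior [simp]: "space (posterior D \<epsilon> N x Q Y) = space Q"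
  by (simp_all add: posterior_def)

lemma emeasure_posterior:
  assumes "S \<in> sets Q"
  shows "emeasure (posterior D \<epsilon> N x Q Y) S
    = (\<integral>\<^sup>+v. ennreal (likelihood D \<epsilon> N x v Y) * indicator S v \<partial>Q) / evidence Y"
proof -
  have "emeasure (posterior D \<epsilon> N x Q Y) S
      = (\<integral>\<^sup>+v. (ennreal (likelihood D \<epsilon> N x v Y) * indicator S v) / evidence Y \<partial>Q)"
    unfolding posterior_def evidence_def[symmetric] using assms
    by (subst emeasure_density) (auto simp: divide_ennreal_def mult_ac)
  also have "\<dots> = (\<integral>\<^sup>+v. ennreal (likelihood D \<epsilon> N x v Y) * indicator S v \<partial>Q) / evidence Y"
    using assms by (intro nn_integral_divide) auto
  finally show ?thesis .
qed

lemma prob_space_posterior: "prob_space (posterior D \<epsilon> N x Q Y)"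
proof
  have "(\<integral>\<^sup>+v. ennreal (likelihood D \<epsilon> N x v Y) * indicator (space Q) v \<partial>Q) = evidence Y"
    unfolding evidence_def by (intro nn_integral_cong) auto
  then show "emeasure (posterior D \<epsilon> N x Q Y) (space (posterior D \<epsilon> N x Q Y)) = 1"
    using evidence_nonzero[of Y] evidence_finite[of Y] by (simp add: emeasure_posterior ennreal_divide_self)
qed

text \<open>
  Convergence in probability of posterior probabilities carries information only if the events
  concerned are measurable, because \<open>measure\<close> is \<open>0\<close> on all other sets.
\<close>

lemma borel_measurable_posterior:
  assumes S: "S \<in> sets Q"
  shows "(\<lambda>Y. measure (posterior D \<epsilon> N x Q Y) S) \<in> borel_measurable (PiM {..<N} (\<lambda>_. borel))"
proof -
  let ?P = "PiM {..<N} (\<lambda>_. borel) :: (nat \<Rightarrow> real) measure"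
  have [measurable]: "(\<lambda>(Y, v). likelihood D \<epsilon> N x v Y) \<in> borel_measurable (?P \<Otimes>\<^sub>M Q)"
    unfolding case_prod_beta by (intro borel_measurable_likelihood) auto
  have "(\<lambda>Y. enn2real ((\<integral>\<^sup>+v. ennreal (likelihood D \<epsilon> N x v Y) * indicator S v \<partial>Q)
      / (\<integral>\<^sup>+v. ennreal (likelihood D \<epsilon> N x v Y) \<partial>Q))) \<in> borel_measurable ?P"
    using S by measurable
  then show ?thesis
    by (simp add: measure_def emeasure_posterior[OF S] evidence_def)
qed

end

section \<open>Transfer of convergence in probability\<close>

lemma prob_space_data_law: "prob_space (data_law D \<epsilon> N x v)"
  and sets_data_law: "sets (data_law D \<epsilon> N x v) = sets (PiM {..<N} (\<lambda>_. borel))"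
proof -
  interpret product_prob_space "\<lambda>_. std_normal_distribution" "{..<N}"
    by (intro product_prob_spaceI prob_space_normal_density) simp
  show "prob_space (data_law D \<epsilon> N x v)"
    unfolding data_law_def by (intro prob_space_distr measurable_restrict) measurable
qed (simp add: data_law_def)

text \<open>
  For a non-measurable \<open>B\<close> the left-hand side is \<open>0\<close>. In the application \<open>Q\<close> is the posterior of \<open>v\<close>,
  \<open>B\<close> the preimage under \<open>e\<close> of the parameters far from \<open>\<gamma>\<^sub>0\<close>, and \<open>F\<close> the set of \<open>v\<close> far from \<open>v\<^sub>0\<close>.
\<close>

lemma prob_le_compl_add:
  assumes Q: "prob_space Q" and sets: "V \<in> sets Q" "F \<in> sets Q" "B \<subseteq> space Q" and sub: "B \<inter> V \<subseteq> F"
  shows "measure Q B \<le> (1 - measure Q V) + measure Q F"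
proof -
  interpret prob_space Q by (rule Q)
  have "measure Q B \<le> measure Q ((space Q - V) \<union> F)"
    using sets sub by (intro finite_measure_mono) auto
  also have "\<dots> \<le> measure Q (space Q - V) + measure Q F"
    using sets by (intro measure_Un_le) auto
  finally show ?thesis using sets by (simp add: prob_compl)
qed

text \<open>
  An inequality is enough for upper bounds and holds for arbitrary \<open>S\<close>, as \<open>measure\<close> is \<open>0\<close> on
  non-measurable sets.
\<close>

lemma measure_induced_law_le:
  assumes A: "A \<in> sets Q" and sets: "sets Q = sets (L2_borel D)"
    and e: "e_of K gt \<in> measurable (restrict_space (L2_borel D) A) (L2_borel D)"
  shows "measure (induced_law D K gt A Q) S \<le> measure Q (e_of K gt -` S \<inter> A)"
proof (cases "S \<in> sets (L2_borel D)")
  case True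
  have e': "e_of K gt \<in> measurable (restrict_space Q A) (L2_borel D)"
    using e measurable_cong_sets[OF sets_restrict_space_cong[OF sets] refl] by blast
  have "measure (induced_law D K gt A Q) S = measure (restrict_space Q A) (e_of K gt -` S \<inter> A)"
    using measure_distr[OF e' True] sets.sets_into_space[OF A]
    by (simp add: induced_law_def space_restrict_space Int_absorb2)
  also have "\<dots> = measure Q (e_of K gt -` S \<inter> A)"
    using A by (intro measure_restrict_space) auto
  finally show ?thesis by simp
next
  case False
  then show ?thesis by (simp add: induced_law_def measure_notin_sets)
qed

text \<open>
  If \<open>\<bar>Z - c\<bar>\<close> exceeds \<open>\<eta>\<close>, one of the two dominating deviations exceeds \<open>\<eta> / 2\<close>. Measurability of \<open>X\<close> and
  \<open>Y\<close> makes the union of the two events measurable, and monotonicity then bounds the measure of the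
  event for \<open>Z\<close>, measurable or not.
\<close>

lemma tendsto_in_prob_sum_bound:
  assumes P: "\<And>\<epsilon>. 0 < \<epsilon> \<Longrightarrow> finite_measure (P \<epsilon>)"
    and meas: "\<And>\<epsilon>. 0 < \<epsilon> \<Longrightarrow> X \<epsilon> \<in> borel_measurable (P \<epsilon>)" "\<And>\<epsilon>. 0 < \<epsilon> \<Longrightarrow> Y \<epsilon> \<in> borel_measurable (P \<epsilon>)"
    and lim: "tendsto_in_prob P X a" "tendsto_in_prob P Y b"
    and bound: "\<And>\<epsilon> y. 0 < \<epsilon> \<Longrightarrow> \<bar>Z \<epsilon> y - c\<bar> \<le> \<bar>X \<epsilon> y - a\<bar> + \<bar>Y \<epsilon> y - b\<bar>"
  shows "tendsto_in_prob P Z c"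
  unfolding tendsto_in_prob_def
proof (intro allI impI)
  fix \<eta> :: real assume \<eta>: "0 < \<eta>"
  let ?E = "\<lambda>X a \<epsilon>. {y \<in> space (P \<epsilon>). \<eta> / 2 < \<bar>X \<epsilon> y - a\<bar>}"
  have "((\<lambda>\<epsilon>. measure (P \<epsilon>) (?E X a \<epsilon>) + measure (P \<epsilon>) (?E Y b \<epsilon>)) \<longlongrightarrow> 0 + 0) (at_right 0)"
    using lim[unfolded tendsto_in_prob_def, rule_format, OF half_gt_zero[OF \<eta>]]
    by (rule tendsto_add)
  then have 0: "((\<lambda>\<epsilon>. measure (P \<epsilon>) (?E X a \<epsilon>) + measure (P \<epsilon>) (?E Y b \<epsilon>)) \<longlongrightarrow> 0) (at_right 0)"
    by simp
  have "measure (P \<epsilon>) {y \<in> space (P \<epsilon>). \<eta> < \<bar>Z \<epsilon> y - c\<bar>}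
      \<le> measure (P \<epsilon>) (?E X a \<epsilon>) + measure (P \<epsilon>) (?E Y b \<epsilon>)" if \<epsilon>: "0 < \<epsilon>" for \<epsilon>
  proof -
    interpret finite_measure "P \<epsilon>" by (rule P[OF \<epsilon>])
    have [measurable]: "X \<epsilon> \<in> borel_measurable (P \<epsilon>)" "Y \<epsilon> \<in> borel_measurable (P \<epsilon>)"
      using meas[OF \<epsilon>] .
    have E: "?E X a \<epsilon> \<in> sets (P \<epsilon>)" "?E Y b \<epsilon> \<in> sets (P \<epsilon>)" by measurable
    have "measure (P \<epsilon>) {y \<in> space (P \<epsilon>). \<eta> < \<bar>Z \<epsilon> y - c\<bar>} \<le> measure (P \<epsilon>) (?E X a \<epsilon> \<union> ?E Y b \<epsilon>)"
    proof (rule finite_measure_mono)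
      show "{y \<in> space (P \<epsilon>). \<eta> < \<bar>Z \<epsilon> y - c\<bar>} \<subseteq> ?E X a \<epsilon> \<union> ?E Y b \<epsilon>"
      proof
        fix y assume "y \<in> {y \<in> space (P \<epsilon>). \<eta> < \<bar>Z \<epsilon> y - c\<bar>}"
        then show "y \<in> ?E X a \<epsilon> \<union> ?E Y b \<epsilon>" using bound[OF \<epsilon>, of y] by auto
      qed
    qed (use E in auto)
    also have "\<dots> \<le> measure (P \<epsilon>) (?E X a \<epsilon>) + measure (P \<epsilon>) (?E Y b \<epsilon>)"
      using E by (rule measure_Un_le)
    finally show ?thesis .
  qed
  then have "\<forall>\<^sub>F \<epsilon> in at_right 0. norm (measure (P \<epsilon>) {y \<in> space (P \<epsilon>). \<eta> < \<bar>Z \<epsilon> y - c\<bar>})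
      \<le> measure (P \<epsilon>) (?E X a \<epsilon>) + measure (P \<epsilon>) (?E Y b \<epsilon>)"
    by (auto simp: eventually_at_filter)
  then show "((\<lambda>\<epsilon>. measure (P \<epsilon>) {y \<in> space (P \<epsilon>). \<eta> < \<bar>Z \<epsilon> y - c\<bar>}) \<longlongrightarrow> 0) (at_right 0)"
    by (rule Lim_null_comparison[OF _ 0])
qed

theorem proposition3p3:
  fixes D :: "(real^'n::finite) set"
    and \<mu> g gt :: "real^'n \<Rightarrow> real"
    and K :: "(real^'n \<Rightarrow> real) \<Rightarrow> (real^'n \<Rightarrow> real)"
    and \<mu>_min \<mu>_lip g_min m M :: real
    and N :: "real \<Rightarrow> nat" and x :: "real \<Rightarrow> nat \<Rightarrow> real^'n"
    and prior_v prior_\<gamma> :: "real \<Rightarrow> (real^'n \<Rightarrow> real) measure"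
    and post_v post_\<gamma> :: "real \<Rightarrow> (nat \<Rightarrow> real) \<Rightarrow> (real^'n \<Rightarrow> real) measure"
    and P0 :: "real \<Rightarrow> (nat \<Rightarrow> real) measure"
    and A V :: "real \<Rightarrow> (real^'n \<Rightarrow> real) set"
    and Vstar :: "(real^'n \<Rightarrow> real) set"
    and v0 \<gamma>0 :: "real^'n \<Rightarrow> real"
    and \<delta> :: "real \<Rightarrow> real"
  assumes dim: "CARD('n) = 2 \<or> CARD('n) = 3"
    and domain: "bounded_C11_domain D"
    and mu_lipschitz: "\<mu>_lip-lipschitz_on (closure D) \<mu>"
    and mu_elliptic: "0 < \<mu>_min" "\<forall>y\<in>D. \<mu>_min \<le> \<mu> y"
    and boundary_datum: "g \<in> H_half_boundary D" "0 < g_min" "AE y in surface_measure D. g_min \<le> g y"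
    and K: "dirichlet_inverse D \<mu> K"
    and gt: "harmonic_extension D \<mu> g gt"
    \<comment> \<open>observation scheme\<close>
    and design: "filterlim N at_top (at_right 0)" "\<forall>\<epsilon>>0. \<forall>i<N \<epsilon>. x \<epsilon> i \<in> D"
    \<comment> \<open>prior on the admissible set\<close>
    and prior: "\<forall>\<epsilon>>0. prob_space (prior_v \<epsilon>) \<and> sets (prior_v \<epsilon>) = sets (L2_borel D)"
    and admissible: "\<forall>\<epsilon>>0. A \<epsilon> \<in> sets (L2_borel D) \<and> emeasure (prior_v \<epsilon>) (A \<epsilon>) = 1"
      "\<forall>\<epsilon>>0. \<forall>v\<in>A \<epsilon>. AE y in lebesgue_on D. u_of K gt v y \<noteq> 0"
      "\<forall>\<epsilon>>0. e_of K gt \<in> measurable (restrict_space (L2_borel D) (A \<epsilon>)) (L2_borel D)"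
    and induced_prior: "\<forall>\<epsilon>>0. prior_\<gamma> \<epsilon> = induced_law D K gt (A \<epsilon>) (prior_v \<epsilon>)"
    and posterior_v: "\<forall>\<epsilon>>0. \<forall>Y. post_v \<epsilon> Y = posterior D \<epsilon> (N \<epsilon>) (x \<epsilon>) (prior_v \<epsilon>) Y"
    and posterior_\<gamma>: "\<forall>\<epsilon>>0. \<forall>Y. post_\<gamma> \<epsilon> Y = induced_law D K gt (A \<epsilon>) (post_v \<epsilon> Y)"
    \<comment> \<open>truth and the law of the data under it\<close>
    and truth: "v0 \<in> Vstar" "\<gamma>0 = e_of K gt v0"
    and data: "\<forall>\<epsilon>>0. P0 \<epsilon> = data_law D \<epsilon> (N \<epsilon>) (x \<epsilon>) v0"
    and Vstar: "Vstar \<subseteq> L2 D" "0 < m"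
      "\<forall>v\<in>Vstar. AE y in lebesgue_on D. m \<le> u_of K gt v y"
      "\<forall>v\<in>Vstar. AE y in lebesgue_on D. \<bar>e_of K gt v y\<bar> \<le> M"
    and V: "\<forall>\<epsilon>>0. V \<epsilon> \<in> sets (L2_borel D) \<and> V \<epsilon> \<subseteq> Vstar"
    and delta: "mono_on {0<..} \<delta>" "(\<delta> \<longlongrightarrow> 0) (at_right 0)"
    and A1: "\<forall>R. filterlim R at_top (at_right 0) \<longrightarrow>
      tendsto_in_prob P0 (\<lambda>\<epsilon> Y. measure (post_v \<epsilon> Y) {v \<in> L2 D. l2dist D v v0 > R \<epsilon> * \<delta> \<epsilon>}) 0"
    and A2: "tendsto_in_prob P0 (\<lambda>\<epsilon> Y. measure (post_v \<epsilon> Y) (V \<epsilon>)) 1"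
    and A3: "\<forall>\<epsilon>>0. L2_locally_lipschitz_on D (V \<epsilon>) (e_of K gt)"
  shows "\<forall>R. filterlim R at_top (at_right 0) \<longrightarrow>
      tendsto_in_prob P0 (\<lambda>\<epsilon> Y. measure (post_\<gamma> \<epsilon> Y) {\<gamma> \<in> L2 D. l2dist D \<gamma> \<gamma>0 > R \<epsilon> * \<delta> \<epsilon>}) 0"
proof (intro allI impI)
  fix R :: "real \<Rightarrow> real" assume R: "filterlim R at_top (at_right 0)"
  have D: "bounded D" "open D" "D \<noteq> {}"
    using domain by (auto simp: bounded_C11_domain_def)
  obtain C where C: "0 \<le> C" "\<And>v w. v \<in> L2 D \<Longrightarrow> w \<in> L2 D \<Longrightarrow> l2dist D (K v) (K w) \<le> C * l2dist D v w"
    using dirichlet_inverse_L2_lipschitz[OF D lipschitz_on_continuous_on[OF mu_lipschitz]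
        mu_elliptic(1) mu_elliptic(2)[rule_format] K] by blast
  have KL2: "K v \<in> L2 D" if "v \<in> L2 D" for v
    using K that in_H1D(1) unfolding dirichlet_inverse_def in_H10_def by blast
  define L where "L = sqrt 2 / m * (1 + \<bar>M\<bar> * C)"
  have L: "0 < L"
    using Vstar(2) C(1) unfolding L_def
    by (intro mult_pos_pos divide_pos_pos add_pos_nonneg mult_nonneg_nonneg) auto
  have v0: "v0 \<in> L2 D" using truth(1) Vstar(1) by auto
  have lip: "l2dist D (e_of K gt v) \<gamma>0 \<le> L * l2dist D v v0" if "v \<in> Vstar" for v
    unfolding truth(2) L_def
    using e_of_L2_lipschitz[OF C(2) KL2 C(1) Vstar(2)] that truth(1) Vstar by blast
  \<comment> \<open>The Lipschitz constant \<open>L\<close> does not depend on \<open>\<epsilon>\<close>, so dividing the rate factor by it still gives a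
    sequence tending to infinity, to which the contraction of the posterior of \<open>v\<close> applies.\<close>
  define R' where "R' \<epsilon> = inverse L * R \<epsilon>" for \<epsilon>
  have R': "filterlim R' at_top (at_right 0)"
    unfolding R'_def using L by (intro filterlim_tendsto_pos_mult_at_top[OF tendsto_const _ R]) simp
  define F where "F \<epsilon> = {v \<in> L2 D. l2dist D v v0 > R' \<epsilon> * \<delta> \<epsilon>}" for \<epsilon>
  have F: "F \<epsilon> \<in> sets (L2_borel D)" for \<epsilon>
  proof -
    note [measurable] = borel_measurable_l2dist[OF v0]
    have "{v \<in> space (L2_borel D). l2dist D v v0 > R' \<epsilon> * \<delta> \<epsilon>} \<in> sets (L2_borel D)"
      by measurable
    then show ?thesis by (simp add: F_def space_L2_borel)
  qed
  have gp: "gaussian_posterior (prior_v \<epsilon>) D \<epsilon> (N \<epsilon>) (x \<epsilon>)" if "0 < \<epsilon>" for \<epsilon>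
    using prior design(2) D(1,2) that
    by (simp add: gaussian_posterior_def gaussian_posterior_axioms_def)
  have post: "prob_space (post_v \<epsilon> Y)" "sets (post_v \<epsilon> Y) = sets (L2_borel D)" if "0 < \<epsilon>" for \<epsilon> Y
    using gaussian_posterior.prob_space_posterior[OF gp[OF that], of Y]
      gaussian_posterior.sets_posterior[OF gp[OF that], of Y] posterior_v prior that by auto
  have meas: "(\<lambda>Y. measure (post_v \<epsilon> Y) S) \<in> borel_measurable (P0 \<epsilon>)"
    if "0 < \<epsilon>" "S \<in> sets (L2_borel D)" for \<epsilon> S
  proof -
    have "(\<lambda>Y. measure (posterior D \<epsilon> (N \<epsilon>) (x \<epsilon>) (prior_v \<epsilon>) Y) S)
        \<in> borel_measurable (PiM {..<N \<epsilon>} (\<lambda>_. borel))"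
      using prior that by (intro gaussian_posterior.borel_measurable_posterior[OF gp]) auto
    then show ?thesis
      using data posterior_v that by (simp add: measurable_cong_sets[OF sets_data_law refl])
  qed
  show "tendsto_in_prob P0 (\<lambda>\<epsilon> Y. measure (post_\<gamma> \<epsilon> Y) {\<gamma> \<in> L2 D. l2dist D \<gamma> \<gamma>0 > R \<epsilon> * \<delta> \<epsilon>}) 0"
  proof (rule tendsto_in_prob_sum_bound)
    show "finite_measure (P0 \<epsilon>)" if "0 < \<epsilon>" for \<epsilon>
      using data that by (simp add: prob_space.finite_measure[OF prob_space_data_law])
    show "tendsto_in_prob P0 (\<lambda>\<epsilon> Y. measure (post_v \<epsilon> Y) (V \<epsilon>)) 1"
      by (rule A2)
    show "tendsto_in_prob P0 (\<lambda>\<epsilon> Y. measure (post_v \<epsilon> Y) (F \<epsilon>)) 0"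
      unfolding F_def using A1 R' by blast
    show "(\<lambda>Y. measure (post_v \<epsilon> Y) (V \<epsilon>)) \<in> borel_measurable (P0 \<epsilon>)"
      "(\<lambda>Y. measure (post_v \<epsilon> Y) (F \<epsilon>)) \<in> borel_measurable (P0 \<epsilon>)" if "0 < \<epsilon>" for \<epsilon>
      using meas[OF that] V F that by auto
    fix \<epsilon> :: real and Y assume \<epsilon>: "0 < \<epsilon>"
    interpret prob_space "post_v \<epsilon> Y" by (rule post(1)[OF \<epsilon>])
    let ?S = "{\<gamma> \<in> L2 D. l2dist D \<gamma> \<gamma>0 > R \<epsilon> * \<delta> \<epsilon>}"
    let ?B = "e_of K gt -` ?S \<inter> A \<epsilon>"
    have A: "A \<epsilon> \<in> sets (post_v \<epsilon> Y)" using admissible(1) post(2) \<epsilon> by simp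
    have "measure (post_\<gamma> \<epsilon> Y) ?S \<le> measure (post_v \<epsilon> Y) ?B"
      using measure_induced_law_le[OF A post(2)[OF \<epsilon>], of K gt ?S] admissible(3) posterior_\<gamma> \<epsilon> by auto
    also have "\<dots> \<le> (1 - measure (post_v \<epsilon> Y) (V \<epsilon>)) + measure (post_v \<epsilon> Y) (F \<epsilon>)"
    proof (rule prob_le_compl_add[OF post(1)[OF \<epsilon>]])
      show "V \<epsilon> \<in> sets (post_v \<epsilon> Y)" "F \<epsilon> \<in> sets (post_v \<epsilon> Y)"
        using V F post(2) \<epsilon> by auto
      show "?B \<subseteq> space (post_v \<epsilon> Y)" using sets.sets_into_space[OF A] by auto
      show "?B \<inter> V \<epsilon> \<subseteq> F \<epsilon>"
      proof
        fix v assume v: "v \<in> ?B \<inter> V \<epsilon>"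
        then have vs: "v \<in> Vstar" using V \<epsilon> by auto
        have "R \<epsilon> * \<delta> \<epsilon> < L * l2dist D v v0" using v lip[OF vs] by auto
        then have "R' \<epsilon> * \<delta> \<epsilon> < l2dist D v v0" using L by (simp add: R'_def field_simps)
        then show "v \<in> F \<epsilon>" using vs Vstar(1) by (auto simp: F_def)
      qed
    qed
    finally show "\<bar>measure (post_\<gamma> \<epsilon> Y) ?S - 0\<bar>
        \<le> \<bar>measure (post_v \<epsilon> Y) (V \<epsilon>) - 1\<bar> + \<bar>measure (post_v \<epsilon> Y) (F \<epsilon>) - 0\<bar>"
      using prob_le_1[of "V \<epsilon>"] by simp
  qed
qed

end
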